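(* Assume there is $\rho>0$ with $\min_{1\le i\le n}\pi_{f_0}(x_i)\ge\rho$ and $\min_{1\le i\le n}[1-\pi_{f_0}(x_i)]\ge\rho$. Let $m_f$ be a partition of $\{1,\dots,n\}$ into intervals with $|J|\ge\Gamma\log^2(n)$ for all $J\in m_f$, where $\Gamma>0$ is a constant, and let $\mathcal{M}$ be a collection of partitions of $\{1,\dots,n\}$ into intervals such that $m_f$ refines every $m\in\mathcal{M}$ (every element of $m$ is a union of elements of $m_f$). For $m\in\mathcal{M}$ let $S_m$ be the span of $\{\mathbb{1}_J,J\in m\}$, $D_m=|m|$, $\hat f_m=\arg\min_{f\in S_m}\gamma_n(f)$ and $f_m=\arg\min_{f\in S_m}\mathcal{K}(\mathbb{P}_{f_0}^{(n)},\mathbb{P}_f^{(n)})$. Let $(L_m)_{m\in\mathcal{M}}$ be positive weights with $\Sigma=\sum_{m\in\mathcal{M}}\exp(-L_mD_m)<+\infty$. Let $\mu>1$ and $\mathrm{pen}:\mathcal{M}\to\mathbb{R}_+$ satisfy, for all $m\in\mathcal{M}$, $$\mathrm{pen}(m)\ge\mu\frac{D_m}{n}\big(1+6L_m+8\sqrt{L_m}\big).$$ Let $\hat m=\arg\min_{m\in\mathcal{M}}\{\gamma_n(\hat f_m)+\mathrm{pen}(m)\}$ and $\tilde f=\hat f_{\hat m}$. Then, with $C_\mu=2\mu^{1/3}/(\mu^{1/3}-1)$, $$\mathbb{E}_{f_0}\big[h^2(\mathbb{P}^{(n)}_{f_0},\mathbb{P}^{(n)}_{\tilde f})\big]\le C_\mu\inf_{m\in\mathcal{M}}\big\{\mathcal{K}(\mathbb{P}_{f_0}^{(n)},\mathbb{P}_{f_m}^{(n)})+\mathrm{pen}(m)\big\}+\frac{C(\rho,\mu,\Gamma,\Sigma)}{n},$$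 where $C(\rho,\mu,\Gamma,\Sigma)$ is a constant depending only on $\rho,\mu,\Gamma,\Sigma$.
   Context: Logistic regression model: $Y_1,\dots,Y_n\in\{0,1\}$ independent with $\mathbb{E}_{f_0}(Y_i)=\pi_{f_0}(x_i)$, where $\pi_f(x)=e^{f(x)}/(1+e^{f(x)})$; the design is identified with $\{1,\dots,n\}$ (functions are maps $\{1,\dots,n\}\to\mathbb{R}$). $\mathbb{P}^{(n)}_f$ is the law of $(Y_1,\dots,Y_n)$ when the $Y_i$ are independent Bernoulli$(\pi_f(x_i))$. $\gamma_n(f)=\frac1n\sum_{i=1}^n\{\log(1+e^{f(x_i)})-Y_if(x_i)\}$; $\mathcal{K}(\mathbb{P}_{f_0}^{(n)},\mathbb{P}_{f}^{(n)})=\frac1n\sum_{i=1}^n\big[\pi_{f_0}(x_i)\log\frac{\pi_{f_0}(x_i)}{\pi_f(x_i)}+(1-\pi_{f_0}(x_i))\log\frac{1-\pi_{f_0}(x_i)}{1-\pi_f(x_i)}\big]$; the normalized squared Hellinger distance is $h^2(\mathbb{P}_{f_0}^{(n)},\mathbb{P}_{g}^{(n)})=\frac1{2n}\sum_{i=1}^n\big[(\sqrt{\pi_{f_0}(x_i)}-\sqrt{\pi_g(x_i)})^2+(\sqrt{1-\pi_{f_0}(x_i)}-\sqrt{1-\pi_g(x_i)})^2\big]$. $|J|$ is the number of points in the interval $J$.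
   Formalization: Since the argmin of γ_n over S_m may not exist (e.g. all Y_i=0 on a block), γ_n(f̂_m) is read as the infimum over S_m, and π of f̂_m as the limit of π_f along a minimizing sequence in S_m; this agrees with the argmin whenever it exists. *)

theory Defs
  imports Complex_Main
begin

text \<open>Design identified with {1..n}; functions are maps nat => real, only values on {1..n} matter.
  An observation (Y_1,...,Y_n) in {0,1}^n is encoded by the set of indices i with Y_i = 1.\<close>

definition logistic :: "real \<Rightarrow> real" where
  "logistic t = exp t / (1 + exp t)"

definition gamma_n :: "nat \<Rightarrow> nat set \<Rightarrow> (nat \<Rightarrow> real) \<Rightarrow> real" where
  "gamma_n n Y f = (1 / real n) * (\<Sum>i\<in>{1..n}. ln (1 + exp (f i)) - of_bool (i \<in> Y) * f i)"

definition KL_n :: "nat \<Rightarrow> (nat \<Rightarrow> real) \<Rightarrow> (nat \<Rightarrow> real) \<Rightarrow> real" where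
  "KL_n n f0 f = (1 / real n) * (\<Sum>i\<in>{1..n}.
      logistic (f0 i) * ln (logistic (f0 i) / logistic (f i))
    + (1 - logistic (f0 i)) * ln ((1 - logistic (f0 i)) / (1 - logistic (f i))))"

definition hell2_n :: "nat \<Rightarrow> (nat \<Rightarrow> real) \<Rightarrow> (nat \<Rightarrow> real) \<Rightarrow> real" where
  "hell2_n n p q = (1 / (2 * real n)) * (\<Sum>i\<in>{1..n}.
      (sqrt (p i) - sqrt (q i))^2 + (sqrt (1 - p i) - sqrt (1 - q i))^2)"

definition expect_n :: "nat \<Rightarrow> (nat \<Rightarrow> real) \<Rightarrow> (nat set \<Rightarrow> real) \<Rightarrow> real" where
  "expect_n n f0 g = (\<Sum>Y\<in>Pow {1..n}.
      (\<Prod>i\<in>{1..n}. if i \<in> Y then logistic (f0 i) else 1 - logistic (f0 i)) * g Y)"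

definition interval_partition :: "nat \<Rightarrow> nat set set \<Rightarrow> bool" where
  "interval_partition n m \<longleftrightarrow>
     (\<forall>J\<in>m. \<exists>a b. a \<le> b \<and> J = {a..b}) \<and>
     (\<forall>J\<in>m. \<forall>K\<in>m. J \<noteq> K \<longrightarrow> J \<inter> K = {}) \<and>
     \<Union>m = {1..n}"

definition refines :: "nat set set \<Rightarrow> nat set set \<Rightarrow> bool" where
  "refines mf m \<longleftrightarrow> (\<forall>J\<in>m. \<exists>F\<subseteq>mf. J = \<Union>F)"

text \<open>S_m: span of the indicators 1_J, J in m = functions constant on each J.\<close>
definition S_m :: "nat set set \<Rightarrow> (nat \<Rightarrow> real) set" where
  "S_m m = {f. \<forall>J\<in>m. \<forall>i\<in>J. \<forall>j\<in>J. f i = f j}"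

definition min_gamma :: "nat \<Rightarrow> nat set set \<Rightarrow> nat set \<Rightarrow> real" where
  "min_gamma n m Y = Inf (gamma_n n Y ` S_m m)"

text \<open>p is the success-probability vector of the minimum contrast estimator hat f_m
  (argmin of gamma_n over S_m, taken in the closure of the model, since the minimum
  may be attained only at infinite values of f): p is the limit of pi_{f_k} along a
  minimizing sequence f_k in S_m.\<close>
definition is_mce :: "nat \<Rightarrow> nat set set \<Rightarrow> nat set \<Rightarrow> (nat \<Rightarrow> real) \<Rightarrow> bool" where
  "is_mce n m Y p \<longleftrightarrow> (\<exists>fk :: nat \<Rightarrow> nat \<Rightarrow> real.
      (\<forall>k. fk k \<in> S_m m) \<and>
      (\<lambda>k. gamma_n n Y (fk k)) \<longlonglongrightarrow> min_gamma n m Y \<and>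
      (\<forall>i\<in>{1..n}. (\<lambda>k. logistic (fk k i)) \<longlonglongrightarrow> p i))"

end

theory Submission
  imports "HOL-Analysis.Analysis" Defs
begin

text \<open>Write p for the true probabilities, q for their block means over a partition m and a for the
  block means of Y; a is the minimum contrast estimator. Unnormalised, the squared Hellinger loss
  of a is at most four times that of q plus 4/3 times the squared distance of q and a.

  The first distance is controlled by the log-likelihood ratio of q and p, since the square root of
  the likelihood ratio has expectation the Hellinger affinity; the second by the divergence V of
  a from q, which is also the likelihood gain of a over q. The definition of the selected model then
  leaves the oracle terms and, for the selected m, two deviations minus the penalty; each
  of them is bounded by a sum over all m of exponentials weighted by exp (- L D).

  For V one needs exponential moments with nearly the Gaussian constants. On a block J, Chernoff's
  bound gives P(V \<ge> x) \<le> 2 exp (- x), hence E exp (t V) - 1 - t E V \<le> 3 t^2 for t \<le> 1/3;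
  and E V \<le> 3/5 (the limit is 1/2) as soon as J is large in terms of \<rho>. The condition on the
  cardinalities of the blocks is only used for the latter: it holds for all n beyond a threshold
  depending on \<rho> and \<Gamma>, and below it the trivial bound 1 on the loss is absorbed by the
  constant. Since C_\<mu> \<ge> 2, it suffices to obtain the oracle inequality with factor 2.\<close>

section \<open>Product Bernoulli expectations\<close>

definition bern_weight :: "(nat \<Rightarrow> real) \<Rightarrow> nat set \<Rightarrow> nat set \<Rightarrow> real" where
  "bern_weight p A Y = (\<Prod>i\<in>A. if i \<in> Y then p i else 1 - p i)"

text \<open>The index set is arbitrary rather than {1..n}, so that expectations can be evaluated by
  induction on it and localised to a single block.\<close>

definition bern_expect :: "(nat \<Rightarrow> real) \<Rightarrow> nat set \<Rightarrow> (nat set \<Rightarrow> real) \<Rightarrow> real" where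
  "bern_expect p A g = (\<Sum>Y\<in>Pow A. bern_weight p A Y * g Y)"

lemma bern_weight_nonneg:
  assumes "\<And>i. i \<in> A \<Longrightarrow> 0 \<le> p i \<and> p i \<le> 1"
  shows "0 \<le> bern_weight p A Y"
  unfolding bern_weight_def by (rule prod_nonneg) (use assms in auto)

lemma bern_expect_empty [simp]: "bern_expect p {} g = g {}"
  by (simp add: bern_expect_def bern_weight_def)

text \<open>Coordinate i is averaged out first. The exact formulas for sums, products and squares
  below follow from this by induction on the index set.\<close>

lemma bern_expect_insert:
  assumes "finite A" "i \<notin> A"
  shows "bern_expect p (insert i A) g =
    bern_expect p A (\<lambda>Y. p i * g (insert i Y) + (1 - p i) * g Y)"
proof -
  have inj: "inj_on (insert i) (Pow A)"
    using assms(2) by (auto simp: inj_on_def)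
  have disj: "Pow A \<inter> insert i ` Pow A = {}"
    using assms(2) by auto
  have w1: "bern_weight p (insert i A) (insert i Y) = p i * bern_weight p A Y"
    if "Y \<in> Pow A" for Y
  proof -
    have "(\<Prod>j\<in>A. if j \<in> insert i Y then p j else 1 - p j) = (\<Prod>j\<in>A. if j \<in> Y then p j else 1 - p j)"
      using assms(2) by (intro prod.cong) auto
    then show ?thesis
      using assms by (simp add: bern_weight_def)
  qed
  have w2: "bern_weight p (insert i A) Y = (1 - p i) * bern_weight p A Y"
    if "Y \<in> Pow A" for Y
    using that assms by (auto simp: bern_weight_def)
  have "bern_expect p (insert i A) g =
      (\<Sum>Y\<in>Pow A. bern_weight p (insert i A) Y * g Y) +
      (\<Sum>Y\<in>insert i ` Pow A. bern_weight p (insert i A) Y * g Y)"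
    unfolding bern_expect_def Pow_insert
    by (rule sum.union_disjoint) (use assms disj in auto)
  also have "(\<Sum>Y\<in>insert i ` Pow A. bern_weight p (insert i A) Y * g Y) =
      (\<Sum>Y\<in>Pow A. bern_weight p (insert i A) (insert i Y) * g (insert i Y))"
    by (simp add: sum.reindex[OF inj])
  finally have "bern_expect p (insert i A) g =
      (\<Sum>Y\<in>Pow A. bern_weight p (insert i A) Y * g Y +
        bern_weight p (insert i A) (insert i Y) * g (insert i Y))"
    by (simp add: sum.distrib)
  also have "\<dots> = bern_expect p A (\<lambda>Y. p i * g (insert i Y) + (1 - p i) * g Y)"
    unfolding bern_expect_def by (intro sum.cong refl) (simp add: w1 w2 algebra_simps)
  finally show ?thesis .
qed

lemma bern_expect_cong:
  "(\<And>Y. Y \<subseteq> A \<Longrightarrow> g Y = h Y) \<Longrightarrow> bern_expect p A g = bern_expect p A h"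
  unfolding bern_expect_def by (intro sum.cong) auto

lemma bern_expect_mono:
  assumes "\<And>i. i \<in> A \<Longrightarrow> 0 \<le> p i \<and> p i \<le> 1" "\<And>Y. Y \<subseteq> A \<Longrightarrow> g Y \<le> h Y"
  shows "bern_expect p A g \<le> bern_expect p A h"
  unfolding bern_expect_def
  by (intro sum_mono mult_left_mono bern_weight_nonneg) (use assms in auto)

lemma bern_expect_add:
  "bern_expect p A (\<lambda>Y. g Y + h Y) = bern_expect p A g + bern_expect p A h"
  by (simp add: bern_expect_def sum.distrib algebra_simps)

lemma bern_expect_cmult: "bern_expect p A (\<lambda>Y. c * g Y) = c * bern_expect p A g"
  by (simp add: bern_expect_def sum_distrib_left algebra_simps)

lemma bern_expect_sum:
  "bern_expect p A (\<lambda>Y. \<Sum>k\<in>I. g k Y) = (\<Sum>k\<in>I. bern_expect p A (g k))"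
  unfolding bern_expect_def by (simp add: sum_distrib_left) (rule sum.swap)

lemma bern_expect_const:
  assumes "finite A"
  shows "bern_expect p A (\<lambda>_. c) = c"
  using assms
proof (induction A)
  case (insert i A)
  then show ?case by (simp add: bern_expect_insert algebra_simps)
qed simp

lemma bern_expect_prod:
  assumes "finite A"
  shows "bern_expect p A (\<lambda>Y. \<Prod>i\<in>A. if i \<in> Y then u i else v i) =
    (\<Prod>i\<in>A. p i * u i + (1 - p i) * v i)"
  using assms
proof (induction A)
  case (insert i A)
  have "bern_expect p (insert i A) (\<lambda>Y. \<Prod>j\<in>insert i A. if j \<in> Y then u j else v j) =
      bern_expect p A (\<lambda>Y. (p i * u i + (1 - p i) * v i) * (\<Prod>j\<in>A. if j \<in> Y then u j else v j))"
    unfolding bern_expect_insert[OF insert.hyps]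
  proof (rule bern_expect_cong)
    fix Y assume "Y \<subseteq> A"
    then have "i \<notin> Y" using insert.hyps by auto
    have "(\<Prod>j\<in>A. if j \<in> insert i Y then u j else v j) = (\<Prod>j\<in>A. if j \<in> Y then u j else v j)"
      using insert.hyps by (intro prod.cong) auto
    then show "p i * (\<Prod>j\<in>insert i A. if j \<in> insert i Y then u j else v j) +
        (1 - p i) * (\<Prod>j\<in>insert i A. if j \<in> Y then u j else v j) =
        (p i * u i + (1 - p i) * v i) * (\<Prod>j\<in>A. if j \<in> Y then u j else v j)"
      using insert.hyps \<open>i \<notin> Y\<close> by (simp add: algebra_simps)
  qed
  then show ?case
    using insert by (simp add: bern_expect_cmult)
qed simp

lemma bern_expect_sum_coords:
  assumes "finite A"
  shows "bern_expect p A (\<lambda>Y. \<Sum>i\<in>A. if i \<in> Y then u i else v i) =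
    (\<Sum>i\<in>A. p i * u i + (1 - p i) * v i)"
  using assms
proof (induction A)
  case (insert i A)
  have "bern_expect p (insert i A) (\<lambda>Y. \<Sum>j\<in>insert i A. if j \<in> Y then u j else v j) =
      bern_expect p A (\<lambda>Y. (p i * u i + (1 - p i) * v i) + (\<Sum>j\<in>A. if j \<in> Y then u j else v j))"
    unfolding bern_expect_insert[OF insert.hyps]
  proof (rule bern_expect_cong)
    fix Y assume "Y \<subseteq> A"
    then have "i \<notin> Y" using insert.hyps by auto
    have "(\<Sum>j\<in>A. if j \<in> insert i Y then u j else v j) = (\<Sum>j\<in>A. if j \<in> Y then u j else v j)"
      using insert.hyps by (intro sum.cong) auto
    then show "p i * (\<Sum>j\<in>insert i A. if j \<in> insert i Y then u j else v j) +
        (1 - p i) * (\<Sum>j\<in>insert i A. if j \<in> Y then u j else v j) =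
        (p i * u i + (1 - p i) * v i) + (\<Sum>j\<in>A. if j \<in> Y then u j else v j)"
      using insert.hyps \<open>i \<notin> Y\<close> by (simp add: algebra_simps)
  qed
  then show ?case
    using insert by (simp add: bern_expect_add bern_expect_const)
qed simp

text \<open>In the average over coordinate i the cross term vanishes, because p i * (1 - p i) + (1 -
  p i) * (- p i) = 0; so variances add up.\<close>

lemma bern_expect_square_dev:
  assumes "finite A"
  shows "bern_expect p A (\<lambda>Y. (\<Sum>i\<in>A. of_bool (i \<in> Y) - p i)\<^sup>2) = (\<Sum>i\<in>A. p i * (1 - p i))"
  using assms
proof (induction A)
  case (insert i A)
  have "bern_expect p (insert i A) (\<lambda>Y. (\<Sum>j\<in>insert i A. of_bool (j \<in> Y) - p j)\<^sup>2) =
      bern_expect p A (\<lambda>Y. p i * (1 - p i) + (\<Sum>j\<in>A. of_bool (j \<in> Y) - p j)\<^sup>2)"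
    unfolding bern_expect_insert[OF insert.hyps]
  proof (rule bern_expect_cong)
    fix Y assume "Y \<subseteq> A"
    then have "i \<notin> Y" using insert.hyps by auto
    have *: "(\<Sum>j\<in>A. of_bool (j \<in> insert i Y) - p j) = (\<Sum>j\<in>A. of_bool (j \<in> Y) - p j)"
      using insert.hyps by (intro sum.cong) auto
    show "p i * (\<Sum>j\<in>insert i A. of_bool (j \<in> insert i Y) - p j)\<^sup>2 +
        (1 - p i) * (\<Sum>j\<in>insert i A. of_bool (j \<in> Y) - p j)\<^sup>2 =
        p i * (1 - p i) + (\<Sum>j\<in>A. of_bool (j \<in> Y) - p j)\<^sup>2"
      unfolding sum.insert[OF insert.hyps] *
      using \<open>i \<notin> Y\<close> by (simp add: power2_eq_square algebra_simps)
  qed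
  then show ?case
    using insert by (simp add: bern_expect_add bern_expect_const)
qed simp

text \<open>Induction on A with g generalised: averaging out a coordinate of A replaces g by a
  mixture of two functions of the remaining coordinates.\<close>

lemma bern_expect_indep:
  assumes "finite A" "finite B" "A \<inter> B = {}"
  shows "bern_expect p (A \<union> B) (\<lambda>Y. g (Y \<inter> A) * h (Y \<inter> B)) =
    bern_expect p A g * bern_expect p B h"
  using assms
proof (induction A arbitrary: g)
  case empty
  have "bern_expect p B (\<lambda>Y. g {} * h (Y \<inter> B)) = bern_expect p B (\<lambda>Y. g {} * h Y)"
    by (rule bern_expect_cong) (simp add: Int_absorb2)
  then show ?case
    by (simp add: bern_expect_cmult)
next
  case (insert i A)
  have i: "i \<notin> A \<union> B" and fin: "finite (A \<union> B)"
    using insert by auto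
  have "bern_expect p (insert i A \<union> B) (\<lambda>Y. g (Y \<inter> insert i A) * h (Y \<inter> B)) =
      bern_expect p (A \<union> B) (\<lambda>Y. (p i * g (insert i (Y \<inter> A)) + (1 - p i) * g (Y \<inter> A)) * h (Y \<inter> B))"
    unfolding Un_insert_left bern_expect_insert[OF fin i]
  proof (rule bern_expect_cong)
    fix Y assume "Y \<subseteq> A \<union> B"
    then have "i \<notin> Y" "i \<notin> B" using i by auto
    then have "insert i Y \<inter> insert i A = insert i (Y \<inter> A)" "Y \<inter> insert i A = Y \<inter> A"
      "insert i Y \<inter> B = Y \<inter> B" by auto
    then show "p i * (g (insert i Y \<inter> insert i A) * h (insert i Y \<inter> B)) +
         (1 - p i) * (g (Y \<inter> insert i A) * h (Y \<inter> B)) =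
         (p i * g (insert i (Y \<inter> A)) + (1 - p i) * g (Y \<inter> A)) * h (Y \<inter> B)"
      by (simp add: algebra_simps)
  qed
  also have "\<dots> = bern_expect p A (\<lambda>Y. p i * g (insert i Y) + (1 - p i) * g Y) * bern_expect p B h"
    using insert by (intro insert.IH[of "\<lambda>Y. p i * g (insert i Y) + (1 - p i) * g Y"]) auto
  finally show ?case
    using insert by (simp add: bern_expect_insert)
qed

lemma bern_expect_prod_blocks:
  assumes "finite m" "\<And>J. J \<in> m \<Longrightarrow> finite J" "pairwise disjnt m"
  shows "bern_expect p (\<Union>m) (\<lambda>Y. \<Prod>J\<in>m. g J (Y \<inter> J)) = (\<Prod>J\<in>m. bern_expect p J (g J))"
  using assms
proof (induction m)
  case (insert K m)
  have fin: "finite K" "finite (\<Union>m)" and disj: "K \<inter> \<Union>m = {}"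
    using insert.prems insert.hyps by (auto simp: pairwise_insert disjnt_def)
  \<comment> \<open>The remaining factors are made to depend on Y only through
    \<open>Y \<inter> \<Union>m\<close>, the form that \<open>bern_expect_indep\<close>
    requires.\<close>
  have "bern_expect p (\<Union>(insert K m)) (\<lambda>Y. \<Prod>J\<in>insert K m. g J (Y \<inter> J)) =
      bern_expect p (K \<union> \<Union>m) (\<lambda>Y. g K (Y \<inter> K) * (\<Prod>J\<in>m. g J ((Y \<inter> \<Union>m) \<inter> J)))"
  proof -
    have "(\<Prod>J\<in>m. g J ((Y \<inter> \<Union>m) \<inter> J)) = (\<Prod>J\<in>m. g J (Y \<inter> J))" for Y
    proof (intro prod.cong refl)
      fix J assume "J \<in> m"
      then have "(Y \<inter> \<Union>m) \<inter> J = Y \<inter> J" by auto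
      then show "g J ((Y \<inter> \<Union>m) \<inter> J) = g J (Y \<inter> J)" by simp
    qed
    then show ?thesis using insert.hyps by simp
  qed
  also have "\<dots> = bern_expect p K (g K) * bern_expect p (\<Union>m) (\<lambda>Y. \<Prod>J\<in>m. g J (Y \<inter> J))"
    by (rule bern_expect_indep[OF fin disj, where h = "\<lambda>Y. \<Prod>J\<in>m. g J (Y \<inter> J)"])
  also have "bern_expect p (\<Union>m) (\<lambda>Y. \<Prod>J\<in>m. g J (Y \<inter> J)) = (\<Prod>J\<in>m. bern_expect p J (g J))"
    using insert by (intro insert.IH) (auto simp: pairwise_insert)
  finally show ?case using insert.hyps by simp
qed simp

section \<open>Divergence and Hellinger distance of Bernoulli laws\<close>

text \<open>Kullback-Leibler divergence of Bernoulli laws. The values a = 0 and a = 1, which block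
  means of Y can take, are covered: the vanishing factor implements 0 ln 0 = 0.\<close>

definition kl :: "real \<Rightarrow> real \<Rightarrow> real" where
  "kl a b = a * ln (a / b) + (1 - a) * ln ((1 - a) / (1 - b))"

definition hell :: "real \<Rightarrow> real \<Rightarrow> real" where
  "hell a b = ((sqrt a - sqrt b)\<^sup>2 + (sqrt (1 - a) - sqrt (1 - b))\<^sup>2) / 2"

lemma mult_sqrt_ratio:
  fixes a b :: real
  assumes "0 < a"
  shows "a * sqrt (b / a) = sqrt (a * b)"
  using assms by (simp add: real_sqrt_divide real_sqrt_mult real_div_sqrt field_simps)

text \<open>This is ln x \<le> x - 1 at x = sqrt (b / a), multiplied by a.\<close>

lemma mult_ln_ratio_ge:
  fixes a b :: real
  assumes "0 \<le> a" "0 < b"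
  shows "2 * a - 2 * sqrt (a * b) \<le> a * ln (a / b)"
proof (cases "a = 0")
  case False
  then have a: "0 < a" using assms by auto
  have "ln (sqrt (b / a)) \<le> sqrt (b / a) - 1"
    using a assms by (intro ln_le_minus_one) auto
  moreover have "ln (sqrt (b / a)) = - ln (a / b) / 2"
    using a assms by (simp add: ln_sqrt ln_div)
  ultimately have "2 - 2 * sqrt (b / a) \<le> ln (a / b)" by simp
  then have "a * (2 - 2 * sqrt (b / a)) \<le> a * ln (a / b)"
    using a by (intro mult_left_mono) auto
  then show ?thesis using mult_sqrt_ratio[OF a, of b] by (simp add: algebra_simps)
qed auto

lemma hell_eq:
  assumes "0 \<le> a" "a \<le> 1" "0 \<le> b" "b \<le> 1"
  shows "hell a b = 1 - sqrt (a * b) - sqrt ((1 - a) * (1 - b))"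
  using assms by (simp add: hell_def power2_diff real_sqrt_mult)

text \<open>The bounds of \<open>mult_ln_ratio_ge\<close> for success and for failure add up to
  twice 1 minus the Hellinger affinity.\<close>

lemma kl_ge_hell:
  assumes "0 \<le> a" "a \<le> 1" "0 < b" "b < 1"
  shows "2 * hell a b \<le> kl a b"
  using mult_ln_ratio_ge[of a b] mult_ln_ratio_ge[of "1 - a" "1 - b"] assms
  by (simp add: hell_eq kl_def)

lemma hell_nonneg: "0 \<le> hell a b"
  by (simp add: hell_def)

lemma hell_sym: "hell a b = hell b a"
  by (simp add: hell_def power2_commute)

lemma kl_nonneg:
  assumes "0 \<le> a" "a \<le> 1" "0 < b" "b < 1"
  shows "0 \<le> kl a b"
  using kl_ge_hell[OF assms] hell_nonneg[of a b] by linarith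

lemma kl_refl: "kl a a = 0"
  by (cases "a = 0"; cases "a = 1") (auto simp: kl_def)

lemma square_diff_le_sqrt:
  fixes a b :: real
  assumes "0 \<le> a" "a \<le> 1" "0 \<le> b" "b \<le> 1"
  shows "(a - b)\<^sup>2 \<le> 4 * (sqrt a - sqrt b)\<^sup>2"
proof -
  have "(a - b)\<^sup>2 = (sqrt a + sqrt b)\<^sup>2 * (sqrt a - sqrt b)\<^sup>2"
    using assms
    by (metis power_mult_distrib real_sqrt_pow2 square_diff_square_factored power2_eq_square)
  also have "\<dots> \<le> 2\<^sup>2 * (sqrt a - sqrt b)\<^sup>2"
  proof (intro mult_right_mono power_mono)
    show "sqrt a + sqrt b \<le> 2"
      using assms real_sqrt_le_1_iff[of a] real_sqrt_le_1_iff[of b] by linarith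
  qed (use assms in auto)
  finally show ?thesis by simp
qed

text \<open>Pinsker's inequality up to the constant, deduced from the Hellinger bound because sqrt a
  + sqrt b \<le> 2. It serves for a fourth order remainder and for a limit, where a sharp constant
  is not an issue.\<close>

lemma kl_ge_square_diff:
  assumes "0 \<le> a" "a \<le> 1" "0 < b" "b < 1"
  shows "(a - b)\<^sup>2 \<le> 2 * kl a b"
proof -
  have "((1 - a) - (1 - b))\<^sup>2 = (a - b)\<^sup>2"
    by (simp add: power2_eq_square algebra_simps)
  then show ?thesis
    using kl_ge_hell[OF assms] square_diff_le_sqrt[of a b] square_diff_le_sqrt[of "1 - a" "1 - b"] assms
    by (simp add: hell_def)
qed

text \<open>Instance s = 3 of (x + y)^2 \<le> (1 + s) x^2 + (1 + 1/s) y^2. The weight 4 is what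
  twice \<open>bias_dev\<close> absorbs; the small weight 4/3 goes to the estimation error, which
  the penalty has to cover.\<close>

lemma hell_triangle: "hell a c \<le> 4 * hell a b + 4 / 3 * hell b c"
proof -
  have *: "(x - z)\<^sup>2 \<le> 4 * (x - y)\<^sup>2 + 4 / 3 * (y - z)\<^sup>2" for x y z :: real
  proof -
    have "0 \<le> (3 * (x - y) - (y - z))\<^sup>2" by simp
    moreover have "4 * (x - y)\<^sup>2 + 4 / 3 * (y - z)\<^sup>2 - (x - z)\<^sup>2 = (3 * (x - y) - (y - z))\<^sup>2 / 3"
      by (simp add: power2_eq_square field_simps)
    ultimately show ?thesis by linarith
  qed
  have half_sum: "(x + x') / 2 \<le> 4 * ((y + y') / 2) + 4 / 3 * ((z + z') / 2)"
    if "x \<le> 4 * y + 4 / 3 * z" "x' \<le> 4 * y' + 4 / 3 * z'" for x x' y y' z z' :: real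
    using that by (simp add: field_simps)
  show ?thesis
    unfolding hell_def by (intro half_sum *)
qed

section \<open>Upper expansion of the divergence around equal arguments\<close>

lemma ln_one_plus_le_cubic:
  fixes u :: real
  assumes "-1 < u"
  shows "ln (1 + u) \<le> u - u\<^sup>2 / 2 + u ^ 3 / 3"
proof -
  define F where "F u = u - u\<^sup>2 / 2 + u ^ 3 / 3 - ln (1 + u)" for u :: real
  have d: "(F has_real_derivative x ^ 3 / (1 + x)) (at x)" if "-1 < x" for x
  proof -
    have "(F has_real_derivative (1 - x + x\<^sup>2 - 1 / (1 + x))) (at x)"
      unfolding F_def using that by (auto intro!: derivative_eq_intros)
    moreover have "1 - x + x\<^sup>2 - 1 / (1 + x) = x ^ 3 / (1 + x)"
      using that by (simp add: field_simps power2_eq_square power3_eq_cube)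
    ultimately show ?thesis by simp
  qed
  \<comment> \<open>The derivative x^3 / (1 + x) has the sign of x, so F is minimal at 0, where it
    vanishes.\<close>
  have "F 0 \<le> F u"
  proof (cases "0 \<le> u")
    case True
    then show ?thesis
    proof (rule DERIV_nonneg_imp_nondecreasing)
      fix x :: real assume "0 \<le> x"
      then show "\<exists>y. (F has_real_derivative y) (at x) \<and> 0 \<le> y"
        using d[of x] by (intro exI[of _ "x ^ 3 / (1 + x)"]) auto
    qed
  next
    case False
    then have "u \<le> 0" by simp
    then show ?thesis
    proof (rule DERIV_nonpos_imp_nonincreasing)
      fix x :: real assume "u \<le> x" "x \<le> 0"
      moreover from this have "x ^ 3 \<le> 0" by simp
      ultimately show "\<exists>y. (F has_real_derivative y) (at x) \<and> y \<le> 0"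
        using d[of x] assms by (intro exI[of _ "x ^ 3 / (1 + x)"]) (auto simp: divide_nonpos_nonneg)
    qed
  qed
  then show ?thesis by (simp add: F_def)
qed

lemma mult_ln_ratio_le:
  fixes b x :: real
  assumes "0 < b" "0 \<le> b + x"
  shows "(b + x) * ln ((b + x) / b) \<le> x + x\<^sup>2 / (2 * b) - x ^ 3 / (6 * b\<^sup>2) + x ^ 4 / (3 * b ^ 3)"
proof -
  define u where "u = x / b"
  have x: "x = b * u" using assms by (simp add: u_def)
  have u: "0 \<le> 1 + u" using assms by (simp add: u_def field_simps)
  have r: "(b + x) / b = 1 + u" using assms by (simp add: u_def field_simps)
  have "(1 + u) * ln (1 + u) \<le> (1 + u) * (u - u\<^sup>2 / 2 + u ^ 3 / 3)"
  proof (cases "u = -1")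
    case False
    then show ?thesis using u by (intro mult_left_mono ln_one_plus_le_cubic) auto
  qed simp
  then have "b * ((1 + u) * ln (1 + u)) \<le> b * ((1 + u) * (u - u\<^sup>2 / 2 + u ^ 3 / 3))"
    by (rule mult_left_mono) (use assms in simp)
  also have "\<dots> = x + x\<^sup>2 / (2 * b) - x ^ 3 / (6 * b\<^sup>2) + x ^ 4 / (3 * b ^ 3)"
    unfolding x using assms by (simp add: field_simps power2_eq_square power3_eq_cube power4_eq_xxxx)
  finally show ?thesis
    unfolding r using x by (simp add: algebra_simps)
qed

text \<open>The linear terms of the expansions around b and 1 - b cancel, and the quadratic ones
  combine to the Gaussian term. The cubic terms are split into a small multiple of the square and a
  fourth power, which becomes negligible on large blocks.\<close>

lemma kl_le_quartic:
  assumes "0 \<le> a" "a \<le> 1" "0 < \<rho>" "\<rho> \<le> b" "\<rho> \<le> 1 - b"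
  shows "kl a b \<le> (a - b)\<^sup>2 / (2 * (b * (1 - b))) + (a - b)\<^sup>2 / 10
    + (5 / (18 * \<rho> ^ 4) + 2 / (3 * \<rho> ^ 3)) * (a - b) ^ 4"
proof -
  define x where "x = a - b"
  have b: "0 < b" "0 < 1 - b" using assms by auto
  have cubic: "\<bar>x\<bar> ^ 3 / (3 * \<rho>\<^sup>2) \<le> x\<^sup>2 / 10 + 5 / (18 * \<rho> ^ 4) * x ^ 4"
  proof -
    define c where "c = 1 / (3 * \<rho>\<^sup>2)"
    \<comment> \<open>Young's inequality, tuned so that the square receives the factor 1/10; the
      fourth power then receives 5/2 * c^2 = 5 / (18 * \<rho>^4).\<close>
    have "0 \<le> (1 / 5 - c * \<bar>x\<bar>)\<^sup>2 * x\<^sup>2 + 0" by simp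
    then have "c * \<bar>x\<bar> * x\<^sup>2 \<le> (1 / 10 + 5 / 2 * c\<^sup>2 * \<bar>x\<bar>\<^sup>2) * x\<^sup>2"
      by (simp add: power2_eq_square algebra_simps)
    moreover have "c\<^sup>2 = 1 / (9 * \<rho> ^ 4)"
      by (simp add: c_def power_divide power_mult_distrib flip: power_mult)
    moreover have "c * \<bar>x\<bar> * x\<^sup>2 = \<bar>x\<bar> ^ 3 / (3 * \<rho>\<^sup>2)"
      by (simp add: c_def power3_eq_cube power2_eq_square)
    moreover have "(1 / 10 + 5 / 2 * c\<^sup>2 * \<bar>x\<bar>\<^sup>2) * x\<^sup>2 = x\<^sup>2 / 10 + 5 / 2 * c\<^sup>2 * x ^ 4"
      by (simp add: algebra_simps power2_eq_square power4_eq_xxxx)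
    ultimately show ?thesis by simp
  qed
  have c1: "\<bar>x\<bar> ^ 3 / (6 * d\<^sup>2) \<le> \<bar>x\<bar> ^ 3 / (6 * \<rho>\<^sup>2)" if "\<rho> \<le> d" for d
    using that assms by (intro divide_left_mono mult_left_mono power_mono) auto
  have c2: "x ^ 4 / (3 * d ^ 3) \<le> x ^ 4 / (3 * \<rho> ^ 3)" if "\<rho> \<le> d" for d
    using that assms by (intro divide_left_mono mult_left_mono power_mono) auto
  have abs3: "- (x ^ 3 / (6 * d\<^sup>2)) \<le> \<bar>x\<bar> ^ 3 / (6 * d\<^sup>2)" "x ^ 3 / (6 * d\<^sup>2) \<le> \<bar>x\<bar> ^ 3 / (6 * d\<^sup>2)" for d
    using abs_ge_self[of "x ^ 3 / (6 * d\<^sup>2)"] abs_ge_minus_self[of "x ^ 3 / (6 * d\<^sup>2)"]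
    by (auto simp: power_abs abs_divide abs_mult)
  have "kl a b \<le> (x + x\<^sup>2 / (2 * b) - x ^ 3 / (6 * b\<^sup>2) + x ^ 4 / (3 * b ^ 3)) +
     (- x + x\<^sup>2 / (2 * (1 - b)) + x ^ 3 / (6 * (1 - b)\<^sup>2) + x ^ 4 / (3 * (1 - b) ^ 3))"
    unfolding kl_def
  proof (rule add_mono)
    show "a * ln (a / b) \<le> x + x\<^sup>2 / (2 * b) - x ^ 3 / (6 * b\<^sup>2) + x ^ 4 / (3 * b ^ 3)"
      using mult_ln_ratio_le[of b x] b assms by (simp add: x_def)
    have eq: "1 - b + - x = 1 - a" by (simp add: x_def)
    have "(1 - a) * ln ((1 - a) / (1 - b)) \<le> - x + (- x)\<^sup>2 / (2 * (1 - b)) -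
        (- x) ^ 3 / (6 * (1 - b)\<^sup>2) + (- x) ^ 4 / (3 * (1 - b) ^ 3)"
      by (rule mult_ln_ratio_le[of "1 - b" "- x", unfolded eq]) (use assms b in auto)
    then show "(1 - a) * ln ((1 - a) / (1 - b)) \<le>
        - x + x\<^sup>2 / (2 * (1 - b)) + x ^ 3 / (6 * (1 - b)\<^sup>2) + x ^ 4 / (3 * (1 - b) ^ 3)"
      by simp
  qed
  also have "\<dots> \<le> x\<^sup>2 / (2 * b) + x\<^sup>2 / (2 * (1 - b)) + 2 * (\<bar>x\<bar> ^ 3 / (6 * \<rho>\<^sup>2)) + 2 * (x ^ 4 / (3 * \<rho> ^ 3))"
    using c1[of b] c1[of "1 - b"] c2[of b] c2[of "1 - b"] abs3(1)[of b] abs3(2)[of "1 - b"] assms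
    by linarith
  also have "2 * (\<bar>x\<bar> ^ 3 / (6 * \<rho>\<^sup>2)) = \<bar>x\<bar> ^ 3 / (3 * \<rho>\<^sup>2)"
    by simp
  also have "x\<^sup>2 / (2 * b) + x\<^sup>2 / (2 * (1 - b)) = x\<^sup>2 / (2 * (b * (1 - b)))"
    using b by (simp add: field_simps)
  finally have "kl a b \<le> x\<^sup>2 / (2 * (b * (1 - b))) + x\<^sup>2 / 10 + 5 / (18 * \<rho> ^ 4) * x ^ 4 + 2 * (x ^ 4 / (3 * \<rho> ^ 3))"
    using cubic by linarith
  then show ?thesis
    by (simp add: x_def algebra_simps)
qed

section \<open>Deviations on one block\<close>

definition block_mean :: "nat set \<Rightarrow> (nat \<Rightarrow> real) \<Rightarrow> real" where
  "block_mean J g = (\<Sum>i\<in>J. g i) / real (card J)"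

text \<open>Gain in log-likelihood on J when a constant success probability is moved from the mean
  of p to the mean of Y.\<close>

definition block_dev :: "(nat \<Rightarrow> real) \<Rightarrow> nat set \<Rightarrow> nat set \<Rightarrow> real" where
  "block_dev p J Y = real (card J) * kl (block_mean J (\<lambda>i. of_bool (i \<in> Y))) (block_mean J p)"

lemma block_mean_bounds:
  assumes "finite J" "J \<noteq> {}" "\<And>i. i \<in> J \<Longrightarrow> l \<le> g i \<and> g i \<le> u"
  shows "l \<le> block_mean J g" "block_mean J g \<le> u"
proof -
  have N: "0 < real (card J)" using assms by (simp add: card_gt_0_iff)
  have "real (card J) * l \<le> sum g J" "sum g J \<le> real (card J) * u"
    using assms(3) by (auto intro: sum_bounded_below sum_bounded_above)
  then show "l \<le> block_mean J g" "block_mean J g \<le> u"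
    using N by (auto simp: block_mean_def field_simps)
qed

lemma block_mean_in_01:
  assumes "finite J" "J \<noteq> {}" "\<And>i. i \<in> J \<Longrightarrow> 0 < p i \<and> p i < 1"
  shows "0 < block_mean J p" "block_mean J p < 1"
proof -
  have N: "0 < real (card J)" using assms by (simp add: card_gt_0_iff)
  have "0 < sum p J" "0 < (\<Sum>i\<in>J. 1 - p i)"
    using assms by (auto intro!: sum_pos)
  then show "0 < block_mean J p" "block_mean J p < 1"
    using N by (auto simp: block_mean_def sum_subtractf)
qed

lemma block_mean_of_bool:
  assumes "finite J" "Y \<subseteq> J"
  shows "block_mean J (\<lambda>i. of_bool (i \<in> Y)) = real (card Y) / real (card J)"
  using assms by (simp add: block_mean_def Int_absorb1 sum.If_cases of_bool_def)

text \<open>The left side is the likelihood ratio of N trials with k successes, at their own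
  frequency against b.\<close>

lemma exp_card_kl:
  fixes N k :: nat
  assumes "0 < N" "k \<le> N" "0 < b" "b < 1"
  defines "a \<equiv> real k / real N"
  shows "(a / b) ^ k * ((1 - a) / (1 - b)) ^ (N - k) = exp (real N * kl a b)"
proof -
  have pw: "(c / d) ^ j = exp (real N * (c * ln (c / d)))"
    if "0 \<le> c" "0 < d" "real j = real N * c" for c d j
  \<comment> \<open>For j = 0 the power is 1 even if its base is 0; then c = 0, and the exponential
    is 1 as well.\<close>
  proof (cases "j = 0")
    case True
    then show ?thesis using that assms by auto
  next
    case False
    then have "0 < c" using that assms by (metis less_eq_real_def mult_zero_right of_nat_0_eq_iff)
    then have "(c / d) ^ j = exp (real j * ln (c / d))"
      using that by (subst exp_of_nat_mult) simp
    then show ?thesis by (simp only: that mult.assoc)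
  qed
  have "(a / b) ^ k = exp (real N * (a * ln (a / b)))"
    using assms by (intro pw) auto
  moreover have "((1 - a) / (1 - b)) ^ (N - k) = exp (real N * ((1 - a) * ln ((1 - a) / (1 - b))))"
    using assms by (intro pw) (auto simp: field_simps of_nat_diff)
  ultimately show ?thesis
    by (simp add: kl_def algebra_simps flip: exp_add)
qed

text \<open>Change of measure: the likelihood ratio of the block with all success probabilities tilted
  from the mean b to a has expectation at most 1, because its factors have mean 1.\<close>

lemma bern_expect_likelihood_ratio:
  assumes "finite J" "J \<noteq> {}" "\<And>i. i \<in> J \<Longrightarrow> 0 < p i \<and> p i < 1" "0 \<le> a" "a \<le> 1"
  defines "b \<equiv> block_mean J p"
  shows "bern_expect p J (\<lambda>Y. \<Prod>i\<in>J. if i \<in> Y then a / b else (1 - a) / (1 - b)) \<le> 1"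
proof -
  have N: "0 < real (card J)" using assms by (simp add: card_gt_0_iff)
  have b: "0 < b" "b < 1"
    unfolding b_def by (intro block_mean_in_01 assms; assumption)+
  have sp: "sum p J = real (card J) * b" using N by (simp add: b_def block_mean_def)
  let ?x = "\<lambda>i. p i * (a / b) + (1 - p i) * ((1 - a) / (1 - b))"
  have "bern_expect p J (\<lambda>Y. \<Prod>i\<in>J. if i \<in> Y then a / b else (1 - a) / (1 - b)) = (\<Prod>i\<in>J. ?x i)"
    using assms(1) by (rule bern_expect_prod)
  also have "\<dots> \<le> (\<Prod>i\<in>J. exp (?x i - 1))"
  proof (rule prod_mono)
    fix i assume "i \<in> J"
    then show "0 \<le> ?x i \<and> ?x i \<le> exp (?x i - 1)"
      using assms(3)[of i] assms(4,5) b exp_ge_add_one_self[of "?x i - 1"] by auto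
  qed
  also have "\<dots> = exp (\<Sum>i\<in>J. ?x i - 1)"
    using assms(1) by (simp add: exp_sum)
  also have "(\<Sum>i\<in>J. ?x i - 1) = sum p J * (a / b) + (real (card J) - sum p J) * ((1 - a) / (1 - b)) - real (card J)"
    by (simp add: sum.distrib sum_subtractf sum_distrib_right[symmetric] sum_divide_distrib[symmetric])
  also have "\<dots> = 0"
    unfolding sp using b by (simp add: field_simps)
  finally show ?thesis by simp
qed

text \<open>Chernoff's bound on one side of the mean. \<open>Y0\<close> is an element of T nearest
  to the mean, and the likelihood ratio tilted to its frequency is monotone in the number of
  successes; so on all of T it is at least its value exp (block_dev p J Y0) at \<open>Y0\<close>.
  Markov's inequality and \<open>bern_expect_likelihood_ratio\<close> conclude.\<close>

lemma block_weight_le: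
  assumes "finite J" "J \<noteq> {}" "\<And>i. i \<in> J \<Longrightarrow> 0 < p i \<and> p i < 1"
    and T: "T \<subseteq> Pow J" and Y0: "Y0 \<in> T"
    and side: "(\<forall>Y\<in>T. card Y0 \<le> card Y) \<and> block_mean J p \<le> real (card Y0) / real (card J) \<or>
      (\<forall>Y\<in>T. card Y \<le> card Y0) \<and> real (card Y0) / real (card J) \<le> block_mean J p"
  shows "(\<Sum>Y\<in>T. bern_weight p J Y) \<le> exp (- block_dev p J Y0)"
proof -
  define N where "N = card J"
  define b where "b = block_mean J p"
  define a where "a = real (card Y0) / real N"
  define u where "u = a / b"
  define v where "v = (1 - a) / (1 - b)"
  have N: "0 < N" using assms by (simp add: N_def card_gt_0_iff)
  have cY: "card Y \<le> N" if "Y \<in> T" for Y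
    using that T assms(1) by (auto simp: N_def intro: card_mono)
  have a: "0 \<le> a" "a \<le> 1" using cY[OF Y0] N by (auto simp: a_def)
  have b: "0 < b" "b < 1"
    unfolding b_def by (intro block_mean_in_01 assms; assumption)+
  have uv: "0 \<le> u" "0 \<le> v" using a b by (auto simp: u_def v_def)
  have dev: "block_dev p J Y0 = real N * kl a b"
    using T Y0 assms(1) by (subst block_dev_def, subst block_mean_of_bool) (auto simp: N_def a_def b_def)
  have val: "u ^ card Y0 * v ^ (N - card Y0) = exp (real N * kl a b)"
    unfolding u_def v_def a_def by (rule exp_card_kl) (use N b cY[OF Y0] in auto)
  have mono: "u ^ card Y0 * v ^ (N - card Y0) \<le> u ^ card Y * v ^ (N - card Y)" if Y: "Y \<in> T" for Y
    using side
  proof (elim disjE conjE)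
    assume *: "\<forall>Y\<in>T. card Y0 \<le> card Y" "block_mean J p \<le> real (card Y0) / real (card J)"
    then have "b \<le> a" by (simp add: a_def b_def N_def)
    then have "1 \<le> u" "v \<le> 1" using b by (auto simp: u_def v_def)
    then show ?thesis
      using * Y uv by (intro mult_mono power_increasing power_decreasing) auto
  next
    assume *: "\<forall>Y\<in>T. card Y \<le> card Y0" "real (card Y0) / real (card J) \<le> block_mean J p"
    then have "a \<le> b" by (simp add: a_def b_def N_def)
    then have "u \<le> 1" "1 \<le> v" using b by (auto simp: u_def v_def)
    then show ?thesis
      using * Y uv by (intro mult_mono power_increasing power_decreasing) auto
  qed
  have w: "0 \<le> bern_weight p J Y" for Y
    using assms(3) by (intro bern_weight_nonneg) (auto simp: less_imp_le)
  have ratio: "(\<Prod>i\<in>J. if i \<in> Y then u else v) = u ^ card Y * v ^ (N - card Y)" if "Y \<in> Pow J" for Y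
  proof -
    have "J \<inter> - Y = J - Y" by auto
    then show ?thesis
      using that assms(1)
      by (simp add: prod.If_cases Int_absorb1 card_Diff_subset N_def finite_subset)
  qed
  have "exp (real N * kl a b) * (\<Sum>Y\<in>T. bern_weight p J Y) =
      (\<Sum>Y\<in>T. bern_weight p J Y * (u ^ card Y0 * v ^ (N - card Y0)))"
    by (simp add: val sum_distrib_right mult.commute)
  also have "\<dots> \<le> (\<Sum>Y\<in>T. bern_weight p J Y * (u ^ card Y * v ^ (N - card Y)))"
    by (intro sum_mono mult_left_mono mono w)
  also have "\<dots> \<le> (\<Sum>Y\<in>Pow J. bern_weight p J Y * (u ^ card Y * v ^ (N - card Y)))"
    using assms(1) T uv w by (intro sum_mono2) auto
  also have "\<dots> = bern_expect p J (\<lambda>Y. \<Prod>i\<in>J. if i \<in> Y then a / b else (1 - a) / (1 - b))"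
    unfolding bern_expect_def u_def[symmetric] v_def[symmetric] using ratio by (intro sum.cong) auto
  also have "\<dots> \<le> 1"
    unfolding b_def by (rule bern_expect_likelihood_ratio) (use assms a in auto)
  finally show ?thesis
    by (simp add: dev exp_minus field_simps)
qed

text \<open>The event is split at the mean of p. On each side \<open>block_weight_le\<close> applies
  at an outcome nearest to the mean, whose deviation is still at least x; the two sides give the
  factor 2.\<close>

lemma block_dev_tail:
  assumes "finite J" "J \<noteq> {}" "\<And>i. i \<in> J \<Longrightarrow> 0 < p i \<and> p i < 1"
  shows "(\<Sum>Y | Y \<subseteq> J \<and> x \<le> block_dev p J Y. bern_weight p J Y) \<le> 2 * exp (- x)"
proof -
  let ?r = "\<lambda>Y. real (card Y) / real (card J)"
  define T where "T = {Y. Y \<subseteq> J \<and> x \<le> block_dev p J Y}"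
  define Tu where "Tu = {Y \<in> T. block_mean J p \<le> ?r Y}"
  define Tl where "Tl = {Y \<in> T. ?r Y < block_mean J p}"
  have fin: "finite T" using assms(1) by (auto simp: T_def)
  have sub: "Tu \<subseteq> Pow J" "Tl \<subseteq> Pow J" by (auto simp: Tu_def Tl_def T_def)
  have upper: "(\<Sum>Y\<in>Tu. bern_weight p J Y) \<le> exp (- x)"
  proof (cases "Tu = {}")
    case False
    then obtain Y0 where Y0: "Y0 \<in> Tu" "\<forall>Y. Y \<in> Tu \<longrightarrow> card Y0 \<le> card Y"
      using ex_has_least_nat[of "\<lambda>Y. Y \<in> Tu" _ card] by blast
    then have "(\<Sum>Y\<in>Tu. bern_weight p J Y) \<le> exp (- block_dev p J Y0)"
      using sub by (intro block_weight_le assms) (auto simp: Tu_def)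
    also have "\<dots> \<le> exp (- x)" using Y0 by (simp add: Tu_def T_def)
    finally show ?thesis .
  qed simp
  have lower: "(\<Sum>Y\<in>Tl. bern_weight p J Y) \<le> exp (- x)"
  proof (cases "Tl = {}")
    case False
    have "\<forall>Y. Y \<in> Tl \<longrightarrow> card Y < Suc (card J)"
      using sub assms(1) by (auto simp: less_Suc_eq_le intro: card_mono)
    then obtain Y0 where Y0: "Y0 \<in> Tl" "\<forall>Y. Y \<in> Tl \<longrightarrow> card Y \<le> card Y0"
      using False ex_has_greatest_nat[of "\<lambda>Y. Y \<in> Tl" _ card] by (metis ex_in_conv less_or_eq_imp_le)
    then have "(\<Sum>Y\<in>Tl. bern_weight p J Y) \<le> exp (- block_dev p J Y0)"
      using sub by (intro block_weight_le assms) (auto simp: Tl_def)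
    also have "\<dots> \<le> exp (- x)" using Y0 by (simp add: Tl_def T_def)
    finally show ?thesis .
  qed simp
  have "T = Tu \<union> Tl" "Tu \<inter> Tl = {}" by (auto simp: Tu_def Tl_def)
  then have "(\<Sum>Y\<in>T. bern_weight p J Y) = (\<Sum>Y\<in>Tu. bern_weight p J Y) + (\<Sum>Y\<in>Tl. bern_weight p J Y)"
    using fin by (simp add: sum.union_disjoint)
  then show ?thesis using upper lower by (simp add: T_def)
qed

text \<open>The weighted sum of G(V) - G(0) is the integral of G'(x) times the weight of V \<ge> x.
  Exchanging sum and integral is only linearity, as S is finite; the bound B and the primitive
  \<Phi> of G' H avoid improper integrals.\<close>

lemma layer_cake_le:
  fixes w V :: "'a \<Rightarrow> real" and G G' H \<Phi> :: "real \<Rightarrow> real"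
  assumes fin: "finite S" and w: "\<And>y. y \<in> S \<Longrightarrow> 0 \<le> w y"
    and V: "\<And>y. y \<in> S \<Longrightarrow> 0 \<le> V y \<and> V y \<le> B"
    and tail: "\<And>x. 0 \<le> x \<Longrightarrow> (\<Sum>y | y \<in> S \<and> x \<le> V y. w y) \<le> H x"
    and B: "0 \<le> B"
    and G: "\<And>x. 0 \<le> x \<Longrightarrow> (G has_real_derivative G' x) (at x)"
    and G': "\<And>x. 0 \<le> x \<Longrightarrow> 0 \<le> G' x"
    and \<Phi>: "\<And>x. 0 \<le> x \<Longrightarrow> (\<Phi> has_real_derivative G' x * H x) (at x)"
  shows "(\<Sum>y\<in>S. w y * (G (V y) - G 0)) \<le> \<Phi> B - \<Phi> 0"
proof -
  have 1: "((\<lambda>x. if x \<in> {0..V y} then G' x else 0) has_integral (G (V y) - G 0)) {0..B}" if "y \<in> S" for y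
  proof -
    have "(G' has_integral (G (V y) - G 0)) {0..V y}"
      using V[OF that] G
      by (intro fundamental_theorem_of_calculus)
        (auto simp flip: has_real_derivative_iff_has_vector_derivative intro: DERIV_subset)
    moreover have "{0..V y} \<subseteq> {0..B}" using V[OF that] by auto
    ultimately show ?thesis by (subst has_integral_restrict)
  qed
  have 2: "((\<lambda>x. \<Sum>y\<in>S. w y * (if x \<in> {0..V y} then G' x else 0)) has_integral
      (\<Sum>y\<in>S. w y * (G (V y) - G 0))) {0..B}"
    using 1 by (intro has_integral_sum fin has_integral_mult_right)
  have 3: "((\<lambda>x. G' x * H x) has_integral (\<Phi> B - \<Phi> 0)) {0..B}"
    using B \<Phi>
    by (intro fundamental_theorem_of_calculus)
      (auto simp flip: has_real_derivative_iff_has_vector_derivative intro: DERIV_subset)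
  show ?thesis
  proof (rule has_integral_le[OF 2 3])
    fix x assume x: "x \<in> {0..B}"
    then have "(\<Sum>y\<in>S. w y * (if x \<in> {0..V y} then G' x else 0)) = (\<Sum>y\<in>S. if x \<le> V y then w y * G' x else 0)"
      by (intro sum.cong) auto
    also have "\<dots> = (\<Sum>y | y \<in> S \<and> x \<le> V y. w y * G' x)"
      using fin by (simp add: sum.inter_filter)
    also have "\<dots> = G' x * (\<Sum>y | y \<in> S \<and> x \<le> V y. w y)"
      by (simp add: sum_distrib_left mult.commute)
    also have "\<dots> \<le> G' x * H x"
      using x tail G' by (intro mult_left_mono) auto
    finally show "(\<Sum>y\<in>S. w y * (if x \<in> {0..V y} then G' x else 0)) \<le> G' x * H x" .
  qed
qed

section \<open>Moments of the deviation on one block\<close>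

lemma block_dev_nonneg:
  assumes "finite J" "J \<noteq> {}" "\<And>i. i \<in> J \<Longrightarrow> 0 < p i \<and> p i < 1"
  shows "0 \<le> block_dev p J Y"
proof -
  have "0 \<le> block_mean J (\<lambda>i. of_bool (i \<in> Y))" "block_mean J (\<lambda>i. of_bool (i \<in> Y)) \<le> 1"
    by (rule block_mean_bounds[OF assms(1,2), where l = 0 and u = 1]; simp)+
  then show ?thesis
    unfolding block_dev_def using assms
    by (intro mult_nonneg_nonneg kl_nonneg block_mean_in_01) auto
qed

text \<open>Layer cake formula with the tail 2 exp (- x). Without its linear part the exponential
  contributes only second order in t, at most 2 t^2 / (1 - t); the first order is left to the
  sharper bound of \<open>block_dev_mean\<close>.\<close>

lemma block_dev_exp_excess:
  assumes J: "finite J" "J \<noteq> {}" "\<And>i. i \<in> J \<Longrightarrow> 0 < p i \<and> p i < 1"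
    and lam: "0 \<le> t" "t \<le> 1 / 3"
  shows "bern_expect p J (\<lambda>Y. exp (t * block_dev p J Y) - 1 - t * block_dev p J Y) \<le> 3 * t\<^sup>2"
proof -
  define B where "B = Max (block_dev p J ` Pow J)"
  have V: "0 \<le> block_dev p J Y \<and> block_dev p J Y \<le> B" if "Y \<in> Pow J" for Y
    using that J by (auto simp: B_def intro!: block_dev_nonneg)
  then have B: "0 \<le> B" by force
  define \<Phi> where "\<Phi> x = 2 * t * (exp (- x) - exp ((t - 1) * x) / (1 - t))" for x
  have "(\<Sum>Y\<in>Pow J. bern_weight p J Y * ((exp (t * block_dev p J Y) - t * block_dev p J Y) - (exp (t * 0) - t * 0)))
      \<le> \<Phi> B - \<Phi> 0"
  proof (rule layer_cake_le[where H = "\<lambda>x. 2 * exp (- x)" and G' = "\<lambda>x. t * (exp (t * x) - 1)"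
        and G = "\<lambda>x. exp (t * x) - t * x"])
    show "finite (Pow J)" "0 \<le> B" using J B by auto
    show "0 \<le> bern_weight p J Y" for Y
      using J by (intro bern_weight_nonneg) (auto simp: less_imp_le)
    show "0 \<le> block_dev p J Y \<and> block_dev p J Y \<le> B" if "Y \<in> Pow J" for Y
      using V that by blast
    show "(\<Sum>Y | Y \<in> Pow J \<and> x \<le> block_dev p J Y. bern_weight p J Y) \<le> 2 * exp (- x)" for x
      using block_dev_tail[of J p x] J by simp
    show "((\<lambda>x. exp (t * x) - t * x) has_real_derivative t * (exp (t * x) - 1)) (at x)" for x
      by (auto intro!: derivative_eq_intros simp: algebra_simps)
    show "0 \<le> t * (exp (t * x) - 1)" if "0 \<le> x" for x
      using that lam by simp
    show "(\<Phi> has_real_derivative t * (exp (t * x) - 1) * (2 * exp (- x))) (at x)" for x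
    proof -
      have "(\<Phi> has_real_derivative 2 * t * (- exp (- x) - (t - 1) * exp ((t - 1) * x) / (1 - t))) (at x)"
        unfolding \<Phi>_def using lam by (auto intro!: derivative_eq_intros)
      moreover have "(t - 1) * exp ((t - 1) * x) / (1 - t) = - exp ((t - 1) * x)"
        using lam by (simp add: field_simps)
      moreover have "exp ((t - 1) * x) = exp (t * x) * exp (- x)"
        by (simp add: algebra_simps flip: exp_add)
      moreover have "2 * t * (- exp (- x) - - (exp (t * x) * exp (- x))) = t * (exp (t * x) - 1) * (2 * exp (- x))"
        by (simp add: algebra_simps)
      ultimately show ?thesis by metis
    qed
  qed
  also have "\<Phi> B - \<Phi> 0 \<le> 3 * t\<^sup>2"
  proof -
    have "exp (- B) \<le> exp ((t - 1) * B)" using B lam by (simp add: algebra_simps)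
    also have "\<dots> \<le> exp ((t - 1) * B) / (1 - t)" using lam by (simp add: field_simps)
    finally have "\<Phi> B \<le> 0" unfolding \<Phi>_def using lam by (intro mult_nonneg_nonpos) auto
    moreover have "- \<Phi> 0 = 2 * t\<^sup>2 / (1 - t)"
      unfolding \<Phi>_def using lam by (simp add: field_simps power2_eq_square)
    moreover have "2 * t\<^sup>2 / (1 - t) \<le> 2 * t\<^sup>2 / (2 / 3)"
      using lam by (intro divide_left_mono) auto
    ultimately show ?thesis by simp
  qed
  finally show ?thesis by (simp add: bern_expect_def algebra_simps)
qed

text \<open>At t = 1/3 the exponential excess dominates V^2 / 18, and its expectation is at most
  1/3.\<close>

lemma block_dev_second_moment:
  assumes J: "finite J" "J \<noteq> {}" "\<And>i. i \<in> J \<Longrightarrow> 0 < p i \<and> p i < 1"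
  shows "bern_expect p J (\<lambda>Y. (block_dev p J Y)\<^sup>2) \<le> 6"
proof -
  have "bern_expect p J (\<lambda>Y. 1 / 18 * (block_dev p J Y)\<^sup>2) \<le>
      bern_expect p J (\<lambda>Y. exp (1 / 3 * block_dev p J Y) - 1 - 1 / 3 * block_dev p J Y)"
  proof (rule bern_expect_mono)
    fix Y
    have "0 \<le> 1 / 3 * block_dev p J Y" using block_dev_nonneg[of J p Y] J by simp
    from exp_lower_Taylor_quadratic[OF this]
    show "1 / 18 * (block_dev p J Y)\<^sup>2 \<le> exp (1 / 3 * block_dev p J Y) - 1 - 1 / 3 * block_dev p J Y"
      by (simp add: power2_eq_square)
  qed (use J in \<open>auto simp: less_imp_le\<close>)
  also have "\<dots> \<le> 3 * (1 / 3)\<^sup>2"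
    by (rule block_dev_exp_excess) (use J in auto)
  finally show ?thesis
    unfolding bern_expect_cmult by (simp add: power2_eq_square)
qed

text \<open>The value 3/5 is 1/2 + 1/40 + 3/40: the variance against the Gaussian term, the tenth of
  the square with b (1 - b) \<le> 1/4, and the fourth order term 24 c / N with 320 c \<le>
  N.\<close>

lemma block_dev_mean:
  assumes J: "finite J" "J \<noteq> {}" and p: "\<And>i. i \<in> J \<Longrightarrow> \<rho> \<le> p i \<and> \<rho> \<le> 1 - p i" and \<rho>: "0 < \<rho>"
    and large: "320 * (5 / (18 * \<rho> ^ 4) + 2 / (3 * \<rho> ^ 3)) \<le> real (card J)"
  shows "bern_expect p J (block_dev p J) \<le> 3 / 5"
proof -
  define N where "N = real (card J)"
  define c where "c = 5 / (18 * \<rho> ^ 4) + 2 / (3 * \<rho> ^ 3)"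
  define b where "b = block_mean J p"
  define x where "x Y = block_mean J (\<lambda>i. of_bool (i \<in> Y)) - b" for Y
  have N: "0 < N" using J by (simp add: N_def card_gt_0_iff)
  have c: "0 \<le> c" using \<rho> by (simp add: c_def)
  have p01: "0 < p i \<and> p i < 1" if "i \<in> J" for i using p[OF that] \<rho> by auto
  have "\<rho> \<le> b" "b \<le> 1 - \<rho>"
    unfolding b_def
    by (rule block_mean_bounds[OF J, where l = \<rho> and u = "1 - \<rho>"]; use p in force)+
  then have b: "\<rho> \<le> b" "\<rho> \<le> 1 - b" "0 < b" "b < 1" using \<rho> by auto
  have ah: "0 \<le> block_mean J (\<lambda>i. of_bool (i \<in> Y))" "block_mean J (\<lambda>i. of_bool (i \<in> Y)) \<le> 1" for Y
    by (rule block_mean_bounds[OF J, where l = 0 and u = 1]; simp)+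
  define e where "e = 1 / (2 * (b * (1 - b))) + 1 / 10"
  define k1 where "k1 = e / N"
  have bb: "0 < b * (1 - b)" using b by simp
  have pointwise: "block_dev p J Y \<le> k1 * (\<Sum>i\<in>J. of_bool (i \<in> Y) - p i)\<^sup>2 + 4 * c / N * (block_dev p J Y)\<^sup>2" for Y
  proof -
    let ?k = "kl (block_mean J (\<lambda>i. of_bool (i \<in> Y))) b"
    have V: "block_dev p J Y = N * ?k" by (simp add: block_dev_def N_def b_def)
    have xN: "(\<Sum>i\<in>J. of_bool (i \<in> Y) - p i) = N * x Y"
      using N by (simp add: x_def b_def block_mean_def N_def sum_subtractf field_simps)
    have k: "?k \<le> (x Y)\<^sup>2 / (2 * (b * (1 - b))) + (x Y)\<^sup>2 / 10 + c * (x Y) ^ 4"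
      unfolding x_def c_def by (rule kl_le_quartic) (use ah b \<rho> in auto)
    have "(x Y)\<^sup>2 \<le> 2 * ?k"
      unfolding x_def by (rule kl_ge_square_diff) (use ah b in auto)
    then have "((x Y)\<^sup>2)\<^sup>2 \<le> (2 * ?k)\<^sup>2" by (intro power_mono) auto
    \<comment> \<open>The fourth power is turned back into the squared divergence, whose expectation
      \<open>block_dev_second_moment\<close> controls.\<close>
    then have "(x Y) ^ 4 \<le> 4 * ?k\<^sup>2" by (simp add: power_mult_distrib flip: power_mult)
    then have "c * (x Y) ^ 4 \<le> c * (4 * ?k\<^sup>2)" using c by (rule mult_left_mono)
    then have "?k \<le> e * (x Y)\<^sup>2 + 4 * c * ?k\<^sup>2"
      using k by (simp add: e_def algebra_simps)
    then have "N * ?k \<le> N * (e * (x Y)\<^sup>2 + 4 * c * ?k\<^sup>2)"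
      using N by (intro mult_left_mono) auto
    also have "\<dots> = k1 * (N * x Y)\<^sup>2 + 4 * c / N * (N * ?k)\<^sup>2"
      unfolding k1_def using N by (simp add: power2_eq_square algebra_simps)
    finally show ?thesis by (simp add: V xN)
  qed
  \<comment> \<open>Concavity of x (1 - x): replacing the success probabilities by their mean can
    only increase the variance.\<close>
  have var: "(\<Sum>i\<in>J. p i * (1 - p i)) \<le> N * (b * (1 - b))"
  proof -
    have sp: "sum p J = N * b" using N by (simp add: b_def N_def block_mean_def)
    have "0 \<le> (\<Sum>i\<in>J. (p i - b)\<^sup>2)" by (intro sum_nonneg) auto
    also have "\<dots> = (\<Sum>i\<in>J. b\<^sup>2 + (1 - 2 * b) * p i - p i * (1 - p i))"
      by (intro sum.cong refl) (simp add: power2_eq_square algebra_simps)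
    also have "\<dots> = N * b\<^sup>2 + (1 - 2 * b) * (N * b) - (\<Sum>i\<in>J. p i * (1 - p i))"
      unfolding sp[symmetric] sum_subtractf sum.distrib sum_distrib_left by (simp add: N_def)
    also have "N * b\<^sup>2 + (1 - 2 * b) * (N * b) = N * (b * (1 - b))"
      by (simp add: power2_eq_square algebra_simps)
    finally show ?thesis by simp
  qed
  have "bern_expect p J (block_dev p J) \<le>
      bern_expect p J (\<lambda>Y. k1 * (\<Sum>i\<in>J. of_bool (i \<in> Y) - p i)\<^sup>2 + 4 * c / N * (block_dev p J Y)\<^sup>2)"
    by (rule bern_expect_mono) (use p01 pointwise in \<open>auto simp: less_imp_le\<close>)
  also have "\<dots> = k1 * (\<Sum>i\<in>J. p i * (1 - p i)) + 4 * c / N * bern_expect p J (\<lambda>Y. (block_dev p J Y)\<^sup>2)"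
    using J by (simp only: bern_expect_add bern_expect_cmult bern_expect_square_dev)
  also have "\<dots> \<le> k1 * (N * (b * (1 - b))) + 4 * c / N * 6"
  proof (intro add_mono mult_left_mono)
    show "bern_expect p J (\<lambda>Y. (block_dev p J Y)\<^sup>2) \<le> 6"
      by (rule block_dev_second_moment) (use J p01 in auto)
  qed (use var N bb c in \<open>auto simp: k1_def e_def\<close>)
  also have "k1 * (N * (b * (1 - b))) = 1 / 2 + b * (1 - b) / 10"
  proof -
    have "k1 * (N * d) = 1 / 2 + d / 10" if "k1 = (1 / (2 * d) + 1 / 10) / N" "0 < d" for d
      using that N by (simp add: field_simps)
    then show ?thesis using bb by (simp add: k1_def e_def)
  qed
  also have "b * (1 - b) \<le> 1 / 4"
    using zero_le_power2[of "b - 1 / 2"] by (simp add: power2_eq_square algebra_simps)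
  also have "4 * c / N * 6 \<le> 3 / 40"
  proof -
    have "320 * c \<le> N" using large by (simp only: c_def N_def)
    then show ?thesis using N by (simp add: field_simps)
  qed
  finally show ?thesis by simp
qed

text \<open>Mean and excess are combined through 1 + u \<le> exp u.\<close>

lemma block_dev_mgf:
  assumes J: "finite J" "J \<noteq> {}" and p: "\<And>i. i \<in> J \<Longrightarrow> \<rho> \<le> p i \<and> \<rho> \<le> 1 - p i" and \<rho>: "0 < \<rho>"
    and large: "320 * (5 / (18 * \<rho> ^ 4) + 2 / (3 * \<rho> ^ 3)) \<le> real (card J)"
    and t: "0 \<le> t" "t \<le> 1 / 3"
  shows "bern_expect p J (\<lambda>Y. exp (t * block_dev p J Y)) \<le> exp (t * (3 / 5 + 3 * t))"
proof -
  have p01: "0 < p i \<and> p i < 1" if "i \<in> J" for i using p[OF that] \<rho> by auto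
  have "bern_expect p J (\<lambda>Y. exp (t * block_dev p J Y)) =
     bern_expect p J (\<lambda>Y. 1 + (t * block_dev p J Y + (exp (t * block_dev p J Y) - 1 - t * block_dev p J Y)))"
    by simp
  also have "\<dots> = 1 + (t * bern_expect p J (block_dev p J) +
     bern_expect p J (\<lambda>Y. exp (t * block_dev p J Y) - 1 - t * block_dev p J Y))"
    using J(1) by (simp only: bern_expect_add bern_expect_cmult bern_expect_const)
  also have "\<dots> \<le> 1 + (t * (3 / 5) + 3 * t\<^sup>2)"
    using block_dev_mean[OF J p \<rho> large] block_dev_exp_excess[of J p t] J p01 t
    by (intro add_mono mult_left_mono) auto
  also have "\<dots> \<le> exp (t * (3 / 5 + 3 * t))"
    using exp_ge_add_one_self[of "t * (3 / 5 + 3 * t)"] by (simp add: power2_eq_square algebra_simps)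
  finally show ?thesis .
qed

section \<open>Partitions and the minimum contrast estimator\<close>

lemma interval_partition_facts:
  assumes "interval_partition n m"
  shows "finite m" "pairwise disjnt m" "\<Union>m = {1..n}"
    and "\<And>J. J \<in> m \<Longrightarrow> finite J \<and> J \<noteq> {} \<and> J \<subseteq> {1..n}"
proof -
  show U: "\<Union>m = {1..n}" using assms by (simp add: interval_partition_def)
  then have "m \<subseteq> Pow {1..n}" by blast
  then show "finite m" by (rule finite_subset) simp
  show "pairwise disjnt m"
    using assms by (auto simp: interval_partition_def pairwise_def disjnt_def)
  fix J assume J: "J \<in> m"
  then obtain a b where "a \<le> b" "J = {a..b}"
    using assms by (auto simp: interval_partition_def)
  then show "finite J \<and> J \<noteq> {} \<and> J \<subseteq> {1..n}" using Union_upper[OF J] U by auto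
qed

lemma sum_interval_partition:
  assumes "interval_partition n m"
  shows "(\<Sum>i\<in>{1..n}. g i) = (\<Sum>J\<in>m. \<Sum>i\<in>J. g i)"
  using interval_partition_facts[OF assms] sum.Union_disjoint[of m g]
  by (simp add: pairwise_def disjnt_def)

text \<open>On {1..n} this is the orthogonal projection of g onto the functions constant on the
  blocks. It yields the vector q of the introduction from p, and a from the indicator of Y.\<close>

definition part_mean :: "nat set set \<Rightarrow> (nat \<Rightarrow> real) \<Rightarrow> nat \<Rightarrow> real" where
  "part_mean m g i = block_mean (THE J. J \<in> m \<and> i \<in> J) g"

lemma part_mean_eq:
  assumes "interval_partition n m" "J \<in> m" "i \<in> J"
  shows "part_mean m g i = block_mean J g"
proof -
  have "(THE J. J \<in> m \<and> i \<in> J) = J"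
    using interval_partition_facts(2)[OF assms(1)] assms(2,3)
    by (intro the_equality) (auto simp: pairwise_def disjnt_def)
  then show ?thesis by (simp add: part_mean_def)
qed

lemma S_m_map2:
  assumes "f \<in> S_m m" "g \<in> S_m m"
  shows "(\<lambda>i. h (f i) (g i)) \<in> S_m m"
  unfolding S_m_def
proof (intro CollectI ballI)
  fix J i j assume "J \<in> m" "i \<in> J" "j \<in> J"
  then have "f i = f j" "g i = g j" using assms unfolding S_m_def by blast+
  then show "h (f i) (g i) = h (f j) (g j)" by simp
qed

lemma S_m_map: "f \<in> S_m m \<Longrightarrow> (\<lambda>i. h (f i)) \<in> S_m m"
  by (rule S_m_map2[where h = "\<lambda>x _. h x"])

lemma part_mean_in_S_m:
  assumes "interval_partition n m"
  shows "part_mean m g \<in> S_m m"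
  using part_mean_eq[OF assms] by (auto simp: S_m_def)

lemma part_mean_obtain_block:
  assumes "interval_partition n m" "i \<in> {1..n}"
  obtains J where "J \<in> m" "i \<in> J" "part_mean m g i = block_mean J g"
proof -
  obtain J where "J \<in> m" "i \<in> J"
    using assms interval_partition_facts(3)[OF assms(1)] by blast
  then show thesis using part_mean_eq[OF assms(1)] that by blast
qed

lemma part_mean_bounds:
  assumes m: "interval_partition n m" and i: "i \<in> {1..n}"
    and g: "\<And>i. i \<in> {1..n} \<Longrightarrow> l \<le> g i \<and> g i \<le> u"
  shows "l \<le> part_mean m g i" "part_mean m g i \<le> u"
proof -
  obtain J where J: "J \<in> m" "part_mean m g i = block_mean J g"
    using m i by (rule part_mean_obtain_block)
  have f: "finite J" "J \<noteq> {}" "J \<subseteq> {1..n}"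
    using interval_partition_facts(4)[OF m J(1)] by auto
  have g': "l \<le> g j \<and> g j \<le> u" if "j \<in> J" for j using that f(3) g by blast
  show "l \<le> part_mean m g i" "part_mean m g i \<le> u"
    unfolding J(2) by (rule block_mean_bounds[OF f(1,2) g']; assumption)+
qed

lemma part_mean_in_01:
  assumes m: "interval_partition n m" and i: "i \<in> {1..n}"
    and g: "\<And>i. i \<in> {1..n} \<Longrightarrow> 0 < g i \<and> g i < 1"
  shows "0 < part_mean m g i" "part_mean m g i < 1"
proof -
  obtain J where J: "J \<in> m" "part_mean m g i = block_mean J g"
    using m i by (rule part_mean_obtain_block)
  have f: "finite J" "J \<noteq> {}" "J \<subseteq> {1..n}"
    using interval_partition_facts(4)[OF m J(1)] by auto
  have g': "0 < g j \<and> g j < 1" if "j \<in> J" for j using that f(3) g by blast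
  show "0 < part_mean m g i" "part_mean m g i < 1"
    unfolding J(2) by (rule block_mean_in_01[OF f(1,2) g']; assumption)+
qed

text \<open>The residual of the projection is orthogonal to \<open>S_m m\<close>: on each block g
  factors out, and only the sum of h remains.\<close>

lemma sum_mult_part_mean:
  assumes m: "interval_partition n m" and g: "g \<in> S_m m"
  shows "(\<Sum>i\<in>{1..n}. h i * g i) = (\<Sum>i\<in>{1..n}. part_mean m h i * g i)"
  unfolding sum_interval_partition[OF m]
proof (rule sum.cong[OF refl])
  fix J assume J: "J \<in> m"
  have f: "finite J" "J \<noteq> {}" using interval_partition_facts(4)[OF m J] by auto
  then obtain j where j: "j \<in> J" by blast
  have gj: "g i = g j" if "i \<in> J" for i using g J that j unfolding S_m_def by blast
  have "(\<Sum>i\<in>J. h i * g i) = (\<Sum>i\<in>J. h i) * g j"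
    unfolding sum_distrib_right using gj by (intro sum.cong) auto
  also have "\<dots> = real (card J) * (block_mean J h * g j)"
    using f by (simp add: block_mean_def)
  also have "\<dots> = (\<Sum>i\<in>J. block_mean J h * g j)" by simp
  also have "\<dots> = (\<Sum>i\<in>J. part_mean m h i * g i)"
    using gj part_mean_eq[OF m J] by (intro sum.cong) auto
  finally show "(\<Sum>i\<in>J. h i * g i) = (\<Sum>i\<in>J. part_mean m h i * g i)" .
qed

text \<open>The summand is affine in h with slope a difference of logits, which lies in
  \<open>S_m m\<close>; hence h may be replaced by its block means. The indicator of Y as h gives
  differences of contrasts, h = p gives differences of divergences from the truth.\<close>

lemma sum_kl_part_mean:
  assumes m: "interval_partition n m" and q: "q \<in> S_m m" and q01: "\<And>i. i \<in> {1..n} \<Longrightarrow> 0 < q i \<and> q i < 1"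
    and r: "r \<in> S_m m" and r01: "\<And>i. i \<in> {1..n} \<Longrightarrow> 0 < r i \<and> r i < 1"
  shows "(\<Sum>i\<in>{1..n}. (h i * ln (q i) + (1 - h i) * ln (1 - q i)) - (h i * ln (r i) + (1 - h i) * ln (1 - r i))) =
    (\<Sum>i\<in>{1..n}. kl (part_mean m h i) (r i)) - (\<Sum>i\<in>{1..n}. kl (part_mean m h i) (q i))"
proof -
  define s where "s i = ln (q i) - ln (1 - q i) - (ln (r i) - ln (1 - r i))" for i
  define c where "c i = ln (1 - q i) - ln (1 - r i)" for i
  have kl: "kl a x - kl a y = (a * ln y + (1 - a) * ln (1 - y)) - (a * ln x + (1 - a) * ln (1 - x))"
    if "0 < x" "x < 1" "0 < y" "y < 1" for a x y
  proof -
    have "a * ln (a / x) - a * ln (a / y) = a * ln y - a * ln x"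
      using that by (cases "a = 0") (simp_all add: ln_div algebra_simps abs_if ln_div)
    moreover have "(1 - a) * ln ((1 - a) / (1 - x)) - (1 - a) * ln ((1 - a) / (1 - y))
        = (1 - a) * ln (1 - y) - (1 - a) * ln (1 - x)"
      using that by (cases "a = 1") (simp_all add: ln_div algebra_simps)
    ultimately show ?thesis by (simp add: kl_def)
  qed
  have "s \<in> S_m m"
    unfolding s_def by (rule S_m_map2[OF q r])
  then have "(\<Sum>i\<in>{1..n}. h i * s i) = (\<Sum>i\<in>{1..n}. part_mean m h i * s i)"
    by (rule sum_mult_part_mean[OF m])
  then have "(\<Sum>i\<in>{1..n}. h i * s i + c i) = (\<Sum>i\<in>{1..n}. part_mean m h i * s i + c i)"
    by (simp add: sum.distrib)
  also have "\<dots> = (\<Sum>i\<in>{1..n}. kl (part_mean m h i) (r i) - kl (part_mean m h i) (q i))"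
    using q01 r01 by (intro sum.cong refl) (simp add: kl s_def c_def algebra_simps)
  also have "(\<Sum>i\<in>{1..n}. h i * s i + c i) =
     (\<Sum>i\<in>{1..n}. (h i * ln (q i) + (1 - h i) * ln (1 - q i)) - (h i * ln (r i) + (1 - h i) * ln (1 - r i)))"
    by (intro sum.cong refl) (simp add: s_def c_def algebra_simps)
  finally show ?thesis by (simp add: sum_subtractf)
qed

section \<open>Log-likelihood, contrast and minimum contrast estimator\<close>

lemma logistic_bounds: "0 < logistic t" "logistic t < 1"
  by (auto simp: logistic_def add_pos_pos)

lemma logistic_logit:
  assumes "0 < q" "q < 1"
  shows "logistic (ln (q / (1 - q))) = q"
proof -
  have "exp (ln (q / (1 - q))) = q / (1 - q)" using assms by simp
  then show ?thesis using assms by (simp add: logistic_def field_simps)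
qed

lemma ln_logistic: "ln (logistic t) = t - ln (1 + exp t)" "ln (1 - logistic t) = - ln (1 + exp t)"
proof -
  have "0 < 1 + exp t" by (simp add: add_pos_pos)
  then have "1 - logistic t = 1 / (1 + exp t)"
    by (simp add: logistic_def field_simps)
  then show "ln (1 - logistic t) = - ln (1 + exp t)"
    using \<open>0 < 1 + exp t\<close> by (simp add: ln_div)
  show "ln (logistic t) = t - ln (1 + exp t)"
    using \<open>0 < 1 + exp t\<close> by (simp add: logistic_def ln_div)
qed

definition loglik :: "nat \<Rightarrow> nat set \<Rightarrow> (nat \<Rightarrow> real) \<Rightarrow> real" where
  "loglik n Y q = (\<Sum>i\<in>{1..n}. if i \<in> Y then ln (q i) else ln (1 - q i))"

lemma gamma_n_eq_loglik:
  assumes "0 < n"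
  shows "real n * gamma_n n Y f = - loglik n Y (\<lambda>i. logistic (f i))"
proof -
  have "real n * gamma_n n Y f = (\<Sum>i\<in>{1..n}. ln (1 + exp (f i)) - of_bool (i \<in> Y) * f i)"
    using assms by (simp add: gamma_n_def)
  also have "\<dots> = (\<Sum>i\<in>{1..n}. - (if i \<in> Y then ln (logistic (f i)) else ln (1 - logistic (f i))))"
    by (intro sum.cong refl) (simp add: ln_logistic)
  finally show ?thesis by (simp add: loglik_def sum_negf)
qed

lemma loglik_diff:
  fixes Y :: "nat set"
  assumes m: "interval_partition n m" and q: "q \<in> S_m m" and q01: "\<And>i. i \<in> {1..n} \<Longrightarrow> 0 < q i \<and> q i < 1"
    and r: "r \<in> S_m m" and r01: "\<And>i. i \<in> {1..n} \<Longrightarrow> 0 < r i \<and> r i < 1"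
  defines "a \<equiv> part_mean m (\<lambda>i. of_bool (i \<in> Y))"
  shows "loglik n Y q - loglik n Y r = (\<Sum>i\<in>{1..n}. kl (a i) (r i)) - (\<Sum>i\<in>{1..n}. kl (a i) (q i))"
proof -
  have "loglik n Y q - loglik n Y r = (\<Sum>i\<in>{1..n}.
      (of_bool (i \<in> Y) * ln (q i) + (1 - of_bool (i \<in> Y)) * ln (1 - q i)) -
      (of_bool (i \<in> Y) * ln (r i) + (1 - of_bool (i \<in> Y)) * ln (1 - r i)))"
    unfolding loglik_def sum_subtractf[symmetric] by (intro sum.cong) auto
  also have "\<dots> = (\<Sum>i\<in>{1..n}. kl (a i) (r i)) - (\<Sum>i\<in>{1..n}. kl (a i) (q i))"
    unfolding a_def by (rule sum_kl_part_mean) (use assms in auto)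
  finally show ?thesis .
qed

text \<open>The shrunk probability is at least (1 - \<eta>) times the original one, for success and
  for failure alike; this bounds both logarithms by - ln (1 - \<eta>), uniformly in a.\<close>

lemma kl_shrink_le:
  assumes "0 \<le> a" "a \<le> 1" "0 < \<eta>" "\<eta> < 1"
  shows "kl a ((1 - \<eta>) * a + \<eta> / 2) \<le> - ln (1 - \<eta>)"
proof -
  have *: "c * ln (c / ((1 - \<eta>) * c + \<eta> / 2)) \<le> c * - ln (1 - \<eta>)" if "0 \<le> c" for c
  proof (cases "c = 0")
    case False
    then have c: "0 < c" using that by auto
    have pos: "0 < (1 - \<eta>) * c" using c assms by simp
    then have "c / ((1 - \<eta>) * c + \<eta> / 2) \<le> c / ((1 - \<eta>) * c)"
      using c assms by (intro divide_left_mono) (auto intro!: mult_pos_pos add_pos_pos)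
    also have "\<dots> = 1 / (1 - \<eta>)" using c by simp
    finally have "ln (c / ((1 - \<eta>) * c + \<eta> / 2)) \<le> ln (1 / (1 - \<eta>))"
      using c pos assms by (subst ln_le_cancel_iff) (auto intro!: divide_pos_pos add_pos_pos)
    also have "\<dots> = - ln (1 - \<eta>)" using assms by (simp add: ln_div)
    finally show ?thesis using c by (intro mult_left_mono) auto
  qed simp
  have e: "1 - ((1 - \<eta>) * a + \<eta> / 2) = (1 - \<eta>) * (1 - a) + \<eta> / 2"
    by (simp add: field_simps)
  have "kl a ((1 - \<eta>) * a + \<eta> / 2) \<le> a * - ln (1 - \<eta>) + (1 - a) * - ln (1 - \<eta>)"
    unfolding kl_def e using *[of a] *[of "1 - a"] assms by (intro add_mono) auto
  then show ?thesis by (simp add: algebra_simps)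
qed

lemma empirical_bounds:
  assumes "interval_partition n m" "i \<in> {1..n}"
  shows "0 \<le> part_mean m (\<lambda>i. of_bool (i \<in> Y)) i" "part_mean m (\<lambda>i. of_bool (i \<in> Y)) i \<le> 1"
  by (rule part_mean_bounds[OF assms, where l = 0 and u = 1]; simp)+

text \<open>The infimum need not be attained at a finite f when some block mean of Y is 0 or 1; it is
  approached by shrinking the block means towards 1/2.\<close>

lemma min_gamma_eq:
  fixes Y :: "nat set"
  assumes n: "0 < n" and m: "interval_partition n m" and q: "q \<in> S_m m"
    and q01: "\<And>i. i \<in> {1..n} \<Longrightarrow> 0 < q i \<and> q i < 1"
  defines "a \<equiv> part_mean m (\<lambda>i. of_bool (i \<in> Y))"
  shows "real n * min_gamma n m Y = - loglik n Y q - (\<Sum>i\<in>{1..n}. kl (a i) (q i))"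
proof -
  define E where "E = - loglik n Y q - (\<Sum>i\<in>{1..n}. kl (a i) (q i))"
  have a: "0 \<le> a i" "a i \<le> 1" if "i \<in> {1..n}" for i
    unfolding a_def using empirical_bounds[OF m that] by auto
  have g: "real n * gamma_n n Y f = E + (\<Sum>i\<in>{1..n}. kl (a i) (logistic (f i)))" if "f \<in> S_m m" for f
  proof -
    have "(\<lambda>i. logistic (f i)) \<in> S_m m" using that by (rule S_m_map)
    then have "loglik n Y (\<lambda>i. logistic (f i)) - loglik n Y q =
        (\<Sum>i\<in>{1..n}. kl (a i) (q i)) - (\<Sum>i\<in>{1..n}. kl (a i) (logistic (f i)))"
      unfolding a_def by (intro loglik_diff m q) (use q01 logistic_bounds in auto)
    then show ?thesis unfolding gamma_n_eq_loglik[OF n] E_def by linarith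
  qed
  have lower: "E / real n \<le> gamma_n n Y f" if "f \<in> S_m m" for f
  proof -
    have "0 \<le> (\<Sum>i\<in>{1..n}. kl (a i) (logistic (f i)))"
      using a logistic_bounds by (intro sum_nonneg kl_nonneg) auto
    then show ?thesis using g[OF that] n by (simp add: field_simps)
  qed
  have "(\<lambda>_. 0) \<in> S_m m" by (simp add: S_m_def)
  then have ne: "gamma_n n Y ` S_m m \<noteq> {}" by blast
  have "E / real n \<le> min_gamma n m Y"
    unfolding min_gamma_def using ne lower by (intro cInf_greatest) auto
  moreover have "min_gamma n m Y \<le> E / real n"
  proof (rule field_le_epsilon)
    fix e :: real assume e: "0 < e"
    \<comment> \<open>Chosen so that \<open>kl_shrink_le\<close> bounds every divergence by exactly
      e.\<close>
    define \<eta> where "\<eta> = 1 - exp (- e)"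
    have \<eta>: "0 < \<eta>" "\<eta> < 1" "- ln (1 - \<eta>) = e" using e by (auto simp: \<eta>_def)
    define s where "s i = (1 - \<eta>) * a i + \<eta> / 2" for i
    define f where "f i = ln (s i / (1 - s i))" for i
    have s: "0 < s i" "s i < 1" if "i \<in> {1..n}" for i
    proof -
      have "0 \<le> (1 - \<eta>) * a i" "(1 - \<eta>) * a i \<le> (1 - \<eta>) * 1"
        using a[OF that] \<eta> by (intro mult_nonneg_nonneg mult_left_mono; simp)+
      then show "0 < s i" "s i < 1" unfolding s_def using \<eta>(1,2) by (linarith, argo)
    qed
    have "a \<in> S_m m" unfolding a_def by (rule part_mean_in_S_m[OF m])
    then have f: "f \<in> S_m m" unfolding f_def s_def by (rule S_m_map)
    have "(\<Sum>i\<in>{1..n}. kl (a i) (logistic (f i))) \<le> (\<Sum>i\<in>{1..n}. e)"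
    proof (rule sum_mono)
      fix i assume i: "i \<in> {1..n}"
      have "logistic (f i) = s i" unfolding f_def using s[OF i] by (rule logistic_logit)
      then show "kl (a i) (logistic (f i)) \<le> e"
        using kl_shrink_le[of "a i" \<eta>] a[OF i] \<eta> by (simp add: s_def)
    qed
    then have "gamma_n n Y f \<le> E / real n + e"
      using g[OF f] n by (simp add: field_simps)
    moreover have "min_gamma n m Y \<le> gamma_n n Y f"
      unfolding min_gamma_def using f lower by (intro cInf_lower) (auto simp: bdd_below_def)
    ultimately show "min_gamma n m Y \<le> E / real n + e" by simp
  qed
  ultimately show ?thesis using n by (simp add: E_def field_simps)
qed

text \<open>Along a minimizing sequence, n times the excess contrast is the total divergence of the
  block means of Y from the fitted probabilities. It tends to 0, and
  \<open>kl_ge_square_diff\<close> turns this into convergence of the probabilities; so passing to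
  the closure leaves a single estimator on {1..n}.\<close>

lemma is_mce_eq_part_mean:
  assumes n: "0 < n" and m: "interval_partition n m" and mce: "is_mce n m Y pt" and i: "i \<in> {1..n}"
  shows "pt i = part_mean m (\<lambda>i. of_bool (i \<in> Y)) i"
proof -
  define a where "a = part_mean m (\<lambda>i. of_bool (i \<in> Y))"
  obtain fk where fk: "\<And>k. fk k \<in> S_m m" "(\<lambda>k. gamma_n n Y (fk k)) \<longlonglongrightarrow> min_gamma n m Y"
    "(\<lambda>k. logistic (fk k i)) \<longlonglongrightarrow> pt i"
    using mce i unfolding is_mce_def by blast
  have a: "0 \<le> a i" "a i \<le> 1" if "i \<in> {1..n}" for i
    unfolding a_def using empirical_bounds[OF m that] by auto
  have "(a i - logistic (fk k i))\<^sup>2 \<le> 2 * (real n * (gamma_n n Y (fk k) - min_gamma n m Y))" for k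
  proof -
    have q: "(\<lambda>i. logistic (fk k i)) \<in> S_m m" using fk(1) by (rule S_m_map)
    have "(a i - logistic (fk k i))\<^sup>2 \<le> 2 * kl (a i) (logistic (fk k i))"
      using a[OF i] logistic_bounds by (intro kl_ge_square_diff) auto
    also have "kl (a i) (logistic (fk k i)) \<le> (\<Sum>i\<in>{1..n}. kl (a i) (logistic (fk k i)))"
      using i a logistic_bounds by (intro member_le_sum kl_nonneg) auto
    also have "\<dots> = real n * (gamma_n n Y (fk k) - min_gamma n m Y)"
      using min_gamma_eq[OF n m q, of Y] logistic_bounds gamma_n_eq_loglik[OF n, of Y "fk k"]
      by (simp add: a_def algebra_simps)
    finally show ?thesis by simp
  qed
  moreover have "(\<lambda>k. 2 * (real n * (gamma_n n Y (fk k) - min_gamma n m Y))) \<longlonglongrightarrow> 0"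
    using fk(2) by (auto intro!: tendsto_eq_intros)
  ultimately have "(\<lambda>k. (a i - logistic (fk k i))\<^sup>2) \<longlonglongrightarrow> 0"
    by (intro tendsto_sandwich[of "\<lambda>_. 0" "\<lambda>k. (a i - logistic (fk k i))\<^sup>2" _
          "\<lambda>k. 2 * (real n * (gamma_n n Y (fk k) - min_gamma n m Y))"] tendsto_const always_eventually)
      (auto simp del: mult_eq_0_iff)
  moreover have "(\<lambda>k. (a i - logistic (fk k i))\<^sup>2) \<longlonglongrightarrow> (a i - pt i)\<^sup>2"
    by (intro tendsto_intros fk(3))
  ultimately have "(a i - pt i)\<^sup>2 = 0" by (rule LIMSEQ_unique[rotated])
  then show ?thesis by (simp add: a_def)
qed

section \<open>The two deviation terms and the pointwise oracle inequality\<close>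

definition fit_dev :: "nat \<Rightarrow> (nat \<Rightarrow> real) \<Rightarrow> nat set set \<Rightarrow> nat set \<Rightarrow> real" where
  "fit_dev n p m Y = (\<Sum>i\<in>{1..n}. kl (part_mean m (\<lambda>i. of_bool (i \<in> Y)) i) (part_mean m p i))"

text \<open>Log-likelihood ratio of the projection against the truth, shifted by twice the Hellinger
  sum so that exp (bias_dev / 2) has expectation at most 1.\<close>

definition bias_dev :: "nat \<Rightarrow> (nat \<Rightarrow> real) \<Rightarrow> nat set set \<Rightarrow> nat set \<Rightarrow> real" where
  "bias_dev n p m Y = loglik n Y (part_mean m p) - loglik n Y p + 2 * (\<Sum>i\<in>{1..n}. hell (p i) (part_mean m p i))"

text \<open>\<open>hell_triangle\<close> leaves 4 times the Hellinger sum plus 2/3 of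
  \<open>fit_dev\<close>. Adding twice the selection inequality, rewritten by
  \<open>min_gamma_eq\<close>, completes the former to 2 * bias_dev and raises the latter to 2/3 + 2
  = 8/3.\<close>

lemma oracle_pointwise:
  assumes n: "0 < n" and p: "\<And>i. i \<in> {1..n} \<Longrightarrow> 0 < p i \<and> p i < 1"
    and m: "interval_partition n m" and m': "interval_partition n m'"
    and sel: "min_gamma n m' Y + pen' \<le> min_gamma n m Y + pen"
    and mce: "is_mce n m' Y pt"
  shows "(\<Sum>i\<in>{1..n}. hell (p i) (pt i)) \<le>
    2 * bias_dev n p m' Y + 8 / 3 * fit_dev n p m' Y - 2 * real n * pen'
    + 2 * (loglik n Y p - loglik n Y (part_mean m p)) + 2 * real n * pen"
proof -
  let ?a = "\<lambda>m. part_mean m (\<lambda>i. of_bool (i \<in> Y))"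
  have S: "part_mean m p \<in> S_m m" "part_mean m' p \<in> S_m m'"
    by (rule part_mean_in_S_m, fact)+
  have p': "0 < part_mean m p i \<and> part_mean m p i < 1" "0 < part_mean m' p i \<and> part_mean m' p i < 1"
    if "i \<in> {1..n}" for i
    using part_mean_in_01[OF m that, of p] part_mean_in_01[OF m' that, of p] p by auto
  have g1: "real n * min_gamma n m Y = - loglik n Y (part_mean m p) - fit_dev n p m Y"
    unfolding fit_dev_def by (rule min_gamma_eq[OF n m S(1)]) (use p' in auto)
  have g2: "real n * min_gamma n m' Y = - loglik n Y (part_mean m' p) - fit_dev n p m' Y"
    unfolding fit_dev_def by (rule min_gamma_eq[OF n m' S(2)]) (use p' in auto)
  have V0: "0 \<le> fit_dev n p m Y"
    unfolding fit_dev_def using empirical_bounds[OF m] p' by (intro sum_nonneg kl_nonneg) auto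
  have "real n * (min_gamma n m' Y + pen') \<le> real n * (min_gamma n m Y + pen)"
    using sel by (intro mult_left_mono) auto
  then have sel': "- loglik n Y (part_mean m' p) - fit_dev n p m' Y + real n * pen' \<le>
      - loglik n Y (part_mean m p) + real n * pen"
    using g1 g2 V0 by (simp add: algebra_simps)
  have "(\<Sum>i\<in>{1..n}. hell (p i) (pt i)) \<le>
      (\<Sum>i\<in>{1..n}. 4 * hell (p i) (part_mean m' p i) + 2 / 3 * kl (?a m' i) (part_mean m' p i))"
  proof (rule sum_mono)
    fix i assume i: "i \<in> {1..n}"
    have "2 * hell (?a m' i) (part_mean m' p i) \<le> kl (?a m' i) (part_mean m' p i)"
      using empirical_bounds[OF m' i] p'[OF i] by (intro kl_ge_hell) auto
    then show "hell (p i) (pt i) \<le> 4 * hell (p i) (part_mean m' p i) + 2 / 3 * kl (?a m' i) (part_mean m' p i)"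
      using hell_triangle[of "p i" "pt i" "part_mean m' p i"] is_mce_eq_part_mean[OF n m' mce i]
        hell_sym[of "part_mean m' p i" "?a m' i"] by simp
  qed
  also have "\<dots> = 4 * (\<Sum>i\<in>{1..n}. hell (p i) (part_mean m' p i)) + 2 / 3 * fit_dev n p m' Y"
    by (simp add: fit_dev_def sum.distrib sum_distrib_left)
  finally show ?thesis
    using sel' by (simp add: bias_dev_def)
qed

text \<open>The square root of the likelihood ratio has as expectation the product of the affinities
  1 - hell, at most exp of minus the Hellinger sum; the shift in \<open>bias_dev\<close> compensates
  exactly this.\<close>

lemma bias_dev_mgf:
  assumes p: "\<And>i. i \<in> {1..n} \<Longrightarrow> 0 < p i \<and> p i < 1" and m: "interval_partition n m"
  shows "bern_expect p {1..n} (\<lambda>Y. exp (bias_dev n p m Y / 2)) \<le> 1"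
proof -
  let ?q = "part_mean m p"
  have q: "0 < ?q i" "?q i < 1" if "i \<in> {1..n}" for i
    using part_mean_in_01[OF m that, of p] p by auto
  define H where "H = (\<Sum>i\<in>{1..n}. hell (p i) (?q i))"
  have ratio: "exp ((loglik n Y ?q - loglik n Y p) / 2) =
      (\<Prod>i\<in>{1..n}. if i \<in> Y then sqrt (?q i / p i) else sqrt ((1 - ?q i) / (1 - p i)))" for Y
  proof -
    have half: "exp ((ln x - ln y) / 2) = sqrt (x / y)" if "0 < x" "0 < y" for x y :: real
    proof -
      have "(ln x - ln y) / 2 = ln (sqrt (x / y))" using that by (simp add: ln_sqrt ln_div)
      then show ?thesis using that by simp
    qed
    have "exp ((loglik n Y ?q - loglik n Y p) / 2) =
       (\<Prod>i\<in>{1..n}. exp (((if i \<in> Y then ln (?q i) else ln (1 - ?q i)) - (if i \<in> Y then ln (p i) else ln (1 - p i))) / 2))"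
      unfolding loglik_def sum_subtractf[symmetric] sum_divide_distrib by (rule exp_sum) simp
    also have "\<dots> = (\<Prod>i\<in>{1..n}. if i \<in> Y then sqrt (?q i / p i) else sqrt ((1 - ?q i) / (1 - p i)))"
      using p q by (intro prod.cong refl) (auto simp: half)
    finally show ?thesis .
  qed
  have "bern_expect p {1..n} (\<lambda>Y. exp (bias_dev n p m Y / 2)) = bern_expect p {1..n} (\<lambda>Y. exp H *
      (\<Prod>i\<in>{1..n}. if i \<in> Y then sqrt (?q i / p i) else sqrt ((1 - ?q i) / (1 - p i))))"
    unfolding ratio[symmetric] exp_add[symmetric] bias_dev_def H_def
    by (intro bern_expect_cong arg_cong[where f = exp]) (simp add: field_simps)
  also have "\<dots> = exp H * (\<Prod>i\<in>{1..n}. p i * sqrt (?q i / p i) + (1 - p i) * sqrt ((1 - ?q i) / (1 - p i)))"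
    by (simp only: bern_expect_cmult bern_expect_prod[OF finite_atLeastAtMost])
  also have "\<dots> \<le> exp H * (\<Prod>i\<in>{1..n}. exp (- hell (p i) (?q i)))"
  proof (intro mult_left_mono prod_mono)
    fix i assume i: "i \<in> {1..n}"
    have "p i * sqrt (?q i / p i) + (1 - p i) * sqrt ((1 - ?q i) / (1 - p i)) = 1 - hell (p i) (?q i)"
      using p[OF i] q[OF i] by (simp add: mult_sqrt_ratio hell_eq)
    also have "\<dots> \<le> exp (- hell (p i) (?q i))"
      using exp_ge_add_one_self[of "- hell (p i) (?q i)"] by simp
    finally show "0 \<le> p i * sqrt (?q i / p i) + (1 - p i) * sqrt ((1 - ?q i) / (1 - p i)) \<and>
      p i * sqrt (?q i / p i) + (1 - p i) * sqrt ((1 - ?q i) / (1 - p i)) \<le> exp (- hell (p i) (?q i))"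
      using p[OF i] q[OF i] by auto
  qed simp
  also have "\<dots> = 1"
    by (simp add: H_def exp_sum[symmetric] sum_negf flip: exp_add)
  finally show ?thesis .
qed

text \<open>\<open>fit_dev\<close> is a sum of one \<open>block_dev\<close> per block, and the
  blocks are independent, so the bounds of \<open>block_dev_mgf\<close> multiply.\<close>

lemma fit_dev_mgf:
  assumes m: "interval_partition n m" and \<rho>: "0 < \<rho>"
    and p: "\<And>i. i \<in> {1..n} \<Longrightarrow> \<rho> \<le> p i \<and> \<rho> \<le> 1 - p i"
    and large: "\<And>J. J \<in> m \<Longrightarrow> 320 * (5 / (18 * \<rho> ^ 4) + 2 / (3 * \<rho> ^ 3)) \<le> real (card J)"
    and t: "0 \<le> t" "t \<le> 1 / 3"
  shows "bern_expect p {1..n} (\<lambda>Y. exp (t * fit_dev n p m Y)) \<le> exp (t * (3 / 5 + 3 * t) * real (card m))"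
proof -
  note mf = interval_partition_facts[OF m]
  have p01: "0 \<le> p i \<and> p i \<le> 1" if "i \<in> {1..n}" for i
    using p[OF that] \<rho> by auto
  have V: "fit_dev n p m Y = (\<Sum>J\<in>m. block_dev p J (Y \<inter> J))" for Y
    unfolding fit_dev_def sum_interval_partition[OF m]
  proof (rule sum.cong[OF refl])
    fix J assume J: "J \<in> m"
    have "block_mean J (\<lambda>i. of_bool (i \<in> Y \<inter> J)) = block_mean J (\<lambda>i. of_bool (i \<in> Y))"
      by (simp add: block_mean_def)
    then show "(\<Sum>i\<in>J. kl (part_mean m (\<lambda>i. of_bool (i \<in> Y)) i) (part_mean m p i)) = block_dev p J (Y \<inter> J)"
      by (simp add: part_mean_eq[OF m J] block_dev_def)
  qed
  have "bern_expect p {1..n} (\<lambda>Y. exp (t * fit_dev n p m Y)) =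
      bern_expect p (\<Union>m) (\<lambda>Y. \<Prod>J\<in>m. exp (t * block_dev p J (Y \<inter> J)))"
    by (simp add: V mf sum_distrib_left exp_sum)
  also have "\<dots> = (\<Prod>J\<in>m. bern_expect p J (\<lambda>Y. exp (t * block_dev p J Y)))"
    by (rule bern_expect_prod_blocks) (use mf in auto)
  also have "\<dots> \<le> (\<Prod>J\<in>m. exp (t * (3 / 5 + 3 * t)))"
  proof (rule prod_mono)
    fix J assume J: "J \<in> m"
    have f: "finite J" "J \<noteq> {}" "J \<subseteq> {1..n}" using mf(4)[OF J] by auto
    have "bern_expect p J (\<lambda>Y. exp (t * block_dev p J Y)) \<le> exp (t * (3 / 5 + 3 * t))"
      by (rule block_dev_mgf[OF f(1,2) _ \<rho> large[OF J] t]) (use p f(3) in blast)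
    moreover have "0 \<le> bern_expect p J (\<lambda>Y. exp (t * block_dev p J Y))"
      unfolding bern_expect_def using p01 f(3)
      by (intro sum_nonneg mult_nonneg_nonneg bern_weight_nonneg) auto
    ultimately show "0 \<le> bern_expect p J (\<lambda>Y. exp (t * block_dev p J Y)) \<and>
      bern_expect p J (\<lambda>Y. exp (t * block_dev p J Y)) \<le> exp (t * (3 / 5 + 3 * t))" by simp
  qed
  also have "\<dots> = exp (t * (3 / 5 + 3 * t) * real (card m))"
    by (simp add: mult.commute flip: exp_of_nat_mult)
  finally show ?thesis .
qed

section \<open>The oracle inequality\<close>

text \<open>The exponent t is the square root of L clamped to [1/20, 1/3].\<close>

lemma penalty_dominates:
  fixes l :: real
  assumes "0 < l"
  obtains t where "1 / 20 \<le> t" "t \<le> 1 / 3"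
    "2 * l + 4 / 3 * (3 / 5 + 3 * t + l / t) \<le> 1 + 6 * l + 8 * sqrt l"
proof -
  define s where "s = sqrt l"
  have l: "l = s * s" using assms by (simp add: s_def)
  have s: "0 < s" using assms by (simp add: s_def)
  consider "s \<le> 1 / 20" | "1 / 20 \<le> s" "s \<le> 1 / 3" | "1 / 3 \<le> s" by linarith
  then show thesis
  proof cases
    case 1
    \<comment> \<open>The clamp 1/20 is the point where 4/3 * (3/5 + 3 t) equals 1, the constant
      term on the right; here l / t = 20 l is at most s.\<close>
    have "20 * (s * s) \<le> s" using 1 s mult_right_mono[of "20 * s" 1 s] by simp
    then show ?thesis using s by (intro that[of "1 / 20"]) (auto simp: l s_def[symmetric])
  next
    case 2
    then show ?thesis using s by (intro that[of s]) (auto simp: l s_def[symmetric])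
  next
    case 3
    \<comment> \<open>At t = 1/3 the terms in l are 6 l on both sides, and 8 s covers the excess of
      the constants.\<close>
    then show ?thesis using s by (intro that[of "1 / 3"]) (auto simp: l s_def[symmetric])
  qed
qed

text \<open>\<open>oracle_pointwise\<close> is integrated. The selected partition depends on Y, so
  its remainder is bounded by the sum over all of M of nonnegative variables \<open>X m Y\<close>,
  each of expectation at most 60 exp (- L D).\<close>

lemma expected_loss_le:
  fixes p :: "nat \<Rightarrow> real" and M :: "nat set set set" and L pen :: "nat set set \<Rightarrow> real"
  assumes n: "0 < n" and \<rho>: "0 < \<rho>" and p: "\<And>i. i \<in> {1..n} \<Longrightarrow> \<rho> \<le> p i \<and> \<rho> \<le> 1 - p i"
    and M: "finite M" "\<And>m. m \<in> M \<Longrightarrow> interval_partition n m"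
    and large: "\<And>m J. m \<in> M \<Longrightarrow> J \<in> m \<Longrightarrow> 320 * (5 / (18 * \<rho> ^ 4) + 2 / (3 * \<rho> ^ 3)) \<le> real (card J)"
    and L: "\<And>m. m \<in> M \<Longrightarrow> 0 < L m"
    and pen: "\<And>m. m \<in> M \<Longrightarrow> real (card m) * (1 + 6 * L m + 8 * sqrt (L m)) \<le> real n * pen m"
    and sel: "\<And>Y. Y \<subseteq> {1..n} \<Longrightarrow> mhat Y \<in> M \<and>
       (\<forall>m\<in>M. min_gamma n (mhat Y) Y + pen (mhat Y) \<le> min_gamma n m Y + pen m) \<and>
       is_mce n (mhat Y) Y (pt Y)"
    and m: "m \<in> M"
  shows "bern_expect p {1..n} (\<lambda>Y. \<Sum>i\<in>{1..n}. hell (p i) (pt Y i)) \<le>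
    2 * ((\<Sum>i\<in>{1..n}. kl (p i) (part_mean m p i)) + real n * pen m) + 60 * (\<Sum>m\<in>M. exp (- L m * real (card m)))"
proof -
  have p01: "0 < p i \<and> p i < 1" if "i \<in> {1..n}" for i using p[OF that] \<rho> by auto
  have "\<forall>m\<in>M. \<exists>t. 1 / 20 \<le> t \<and> t \<le> 1 / 3 \<and>
      2 * L m + 4 / 3 * (3 / 5 + 3 * t + L m / t) \<le> 1 + 6 * L m + 8 * sqrt (L m)"
    using penalty_dominates L by metis
  then obtain t where t: "\<And>m. m \<in> M \<Longrightarrow> 1 / 20 \<le> t m" "\<And>m. m \<in> M \<Longrightarrow> t m \<le> 1 / 3"
    "\<And>m. m \<in> M \<Longrightarrow> 2 * L m + 4 / 3 * (3 / 5 + 3 * t m + L m / t m) \<le> 1 + 6 * L m + 8 * sqrt (L m)"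
    by metis
  define D where "D m = real (card m)" for m :: "nat set set"
  define e where "e m = exp (- L m * D m)" for m
  \<comment> \<open>The factor 4 is 2 * 2, and 160/3 is 8/3 * 20, where 20 bounds 1 / t. Apart from
    the weight \<open>e m\<close>, each exponential is normalised to expectation at most 1.\<close>
  define X where "X m Y = 4 * (e m * exp (bias_dev n p m Y / 2)) +
     160 / 3 * (e m * (exp (- (t m * (3 / 5 + 3 * t m) * D m)) * exp (t m * fit_dev n p m Y)))" for m Y
  have X0: "0 \<le> X m Y" for m Y by (simp add: X_def e_def)
  have dev: "2 * bias_dev n p m Y + 8 / 3 * fit_dev n p m Y - 2 * real n * pen m \<le> X m Y" if m: "m \<in> M" for m Y
  proof -
    have tp: "0 < t m" using t(1)[OF m] by simp
    let ?y = "t m * fit_dev n p m Y - t m * (3 / 5 + 3 * t m) * D m - L m * D m"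
    \<comment> \<open>Both deviations are bounded through y \<le> exp y with y already reduced by L
      D: the reduction produces the weight \<open>e m\<close>, and the subtracted terms are what the
      penalty must cover.\<close>
    have "bias_dev n p m Y / 2 - L m * D m \<le> exp (bias_dev n p m Y / 2 - L m * D m)"
      using exp_ge_add_one_self[of "bias_dev n p m Y / 2 - L m * D m"] by linarith
    moreover have "exp (bias_dev n p m Y / 2 - L m * D m) = e m * exp (bias_dev n p m Y / 2)"
      by (simp add: e_def flip: exp_add)
    ultimately have 1: "bias_dev n p m Y \<le> 2 * L m * D m + 2 * (e m * exp (bias_dev n p m Y / 2))"
      by simp
    have "?y \<le> exp ?y" using exp_ge_add_one_self[of ?y] by linarith
    then have "?y / t m \<le> exp ?y / t m" using tp by (intro divide_right_mono) auto
    also have "\<dots> \<le> exp ?y / (1 / 20)" using t(1)[OF m] tp by (intro divide_left_mono) auto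
    finally have "?y / t m \<le> 20 * exp ?y" by simp
    moreover have "?y / t m = fit_dev n p m Y - (3 / 5 + 3 * t m + L m / t m) * D m"
      using tp by (simp add: field_simps)
    moreover have "exp ?y = e m * (exp (- (t m * (3 / 5 + 3 * t m) * D m)) * exp (t m * fit_dev n p m Y))"
      by (simp add: e_def flip: exp_add)
    ultimately have 2: "fit_dev n p m Y \<le> (3 / 5 + 3 * t m + L m / t m) * D m +
        20 * (e m * (exp (- (t m * (3 / 5 + 3 * t m) * D m)) * exp (t m * fit_dev n p m Y)))"
      by linarith
    have "(2 * L m + 4 / 3 * (3 / 5 + 3 * t m + L m / t m)) * D m \<le> (1 + 6 * L m + 8 * sqrt (L m)) * D m"
      using t(3)[OF m] by (intro mult_right_mono) (auto simp: D_def)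
    also have "\<dots> \<le> real n * pen m" using pen[OF m] by (simp add: D_def mult.commute)
    finally have 3: "2 * L m * D m + 4 / 3 * ((3 / 5 + 3 * t m + L m / t m) * D m) \<le> real n * pen m"
      by (simp only: distrib_right mult.assoc)
    show ?thesis using 1 2 3 unfolding X_def by linarith
  qed
  have EX: "bern_expect p {1..n} (X m) \<le> 60 * e m" if m: "m \<in> M" for m
  proof -
    have b: "bern_expect p {1..n} (\<lambda>Y. exp (bias_dev n p m Y / 2)) \<le> 1"
      by (rule bias_dev_mgf) (use p01 M m in auto)
    have "bern_expect p {1..n} (\<lambda>Y. exp (t m * fit_dev n p m Y)) \<le> exp (t m * (3 / 5 + 3 * t m) * D m)"
      unfolding D_def by (rule fit_dev_mgf[OF M(2)[OF m] \<rho> p large[OF m]]) (use t(1,2)[OF m] in auto)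
    then have f: "exp (- (t m * (3 / 5 + 3 * t m) * D m)) * bern_expect p {1..n} (\<lambda>Y. exp (t m * fit_dev n p m Y)) \<le> 1"
      by (simp add: exp_minus field_simps)
    have "bern_expect p {1..n} (X m) = 4 * (e m * bern_expect p {1..n} (\<lambda>Y. exp (bias_dev n p m Y / 2))) +
      160 / 3 * (e m * (exp (- (t m * (3 / 5 + 3 * t m) * D m)) * bern_expect p {1..n} (\<lambda>Y. exp (t m * fit_dev n p m Y))))"
      unfolding X_def by (simp only: bern_expect_add bern_expect_cmult)
    also have "\<dots> \<le> 4 * (e m * 1) + 160 / 3 * (e m * 1)"
      using b f by (intro add_mono mult_left_mono) (auto simp: e_def)
    also have "\<dots> \<le> 60 * e m" by (simp add: e_def)
    finally show ?thesis .
  qed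
  have kl01: "0 < part_mean m p i \<and> part_mean m p i < 1" if "i \<in> {1..n}" for i
    using part_mean_in_01[OF M(2)[OF m] that, of p] p01 by auto
  have Eb: "bern_expect p {1..n} (\<lambda>Y. loglik n Y p - loglik n Y (part_mean m p)) = (\<Sum>i\<in>{1..n}. kl (p i) (part_mean m p i))"
  proof -
    have "bern_expect p {1..n} (\<lambda>Y. loglik n Y p - loglik n Y (part_mean m p)) =
        bern_expect p {1..n} (\<lambda>Y. \<Sum>i\<in>{1..n}. if i \<in> Y then ln (p i / part_mean m p i) else ln ((1 - p i) / (1 - part_mean m p i)))"
    proof (rule bern_expect_cong)
      fix Y
      show "loglik n Y p - loglik n Y (part_mean m p) = (\<Sum>i\<in>{1..n}. if i \<in> Y then ln (p i / part_mean m p i) else ln ((1 - p i) / (1 - part_mean m p i)))"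
        unfolding loglik_def sum_subtractf[symmetric]
      proof (intro sum.cong refl)
        fix i assume i: "i \<in> {1..n}"
        show "(if i \<in> Y then ln (p i) else ln (1 - p i)) - (if i \<in> Y then ln (part_mean m p i) else ln (1 - part_mean m p i)) =
            (if i \<in> Y then ln (p i / part_mean m p i) else ln ((1 - p i) / (1 - part_mean m p i)))"
          using p01[OF i] kl01[OF i] by (simp add: ln_div)
      qed
    qed
    then show ?thesis by (simp add: bern_expect_sum_coords kl_def)
  qed
  have "bern_expect p {1..n} (\<lambda>Y. \<Sum>i\<in>{1..n}. hell (p i) (pt Y i)) \<le>
     bern_expect p {1..n} (\<lambda>Y. (\<Sum>m\<in>M. X m Y) + (2 * (loglik n Y p - loglik n Y (part_mean m p)) + 2 * real n * pen m))"
  proof (rule bern_expect_mono)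
    fix Y assume Y: "Y \<subseteq> {1..n}"
    note s = sel[OF Y]
    have "(\<Sum>i\<in>{1..n}. hell (p i) (pt Y i)) \<le>
        2 * bias_dev n p (mhat Y) Y + 8 / 3 * fit_dev n p (mhat Y) Y - 2 * real n * pen (mhat Y)
        + 2 * (loglik n Y p - loglik n Y (part_mean m p)) + 2 * real n * pen m"
      by (rule oracle_pointwise) (use n p01 M m s in auto)
    also have "\<dots> \<le> X (mhat Y) Y + 2 * (loglik n Y p - loglik n Y (part_mean m p)) + 2 * real n * pen m"
      using dev[of "mhat Y" Y] s by simp
    also have "X (mhat Y) Y \<le> (\<Sum>m\<in>M. X m Y)"
      using s M X0 by (intro member_le_sum) auto
    finally show "(\<Sum>i\<in>{1..n}. hell (p i) (pt Y i)) \<le>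
        (\<Sum>m\<in>M. X m Y) + (2 * (loglik n Y p - loglik n Y (part_mean m p)) + 2 * real n * pen m)" by simp
  qed (use p01 in \<open>auto simp: less_imp_le\<close>)
  also have "\<dots> = (\<Sum>m\<in>M. bern_expect p {1..n} (X m)) + (2 * (\<Sum>i\<in>{1..n}. kl (p i) (part_mean m p i)) + 2 * real n * pen m)"
    by (simp only: bern_expect_add bern_expect_sum bern_expect_cmult bern_expect_const[OF finite_atLeastAtMost] Eb)
  also have "\<dots> \<le> (\<Sum>m\<in>M. 60 * e m) + (2 * (\<Sum>i\<in>{1..n}. kl (p i) (part_mean m p i)) + 2 * real n * pen m)"
    using EX by (intro add_right_mono sum_mono)
  finally show ?thesis
    by (simp add: e_def D_def sum_distrib_left algebra_simps)
qed

section \<open>The normalised quantities of the theorem and its conclusion\<close>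

lemma KL_n_eq: "KL_n n f0 f = (\<Sum>i\<in>{1..n}. kl (logistic (f0 i)) (logistic (f i))) / real n"
  by (simp add: KL_n_def kl_def)

lemma hell2_n_eq: "hell2_n n p q = (\<Sum>i\<in>{1..n}. hell (p i) (q i)) / real n"
  by (simp add: hell2_n_def hell_def sum_divide_distrib[symmetric])

lemma expect_n_eq: "expect_n n f0 g = bern_expect (\<lambda>i. logistic (f0 i)) {1..n} g"
  by (simp add: expect_n_def bern_expect_def bern_weight_def)

lemma KL_n_nonneg: "0 \<le> KL_n n f0 f"
  unfolding KL_n_eq using logistic_bounds
  by (intro divide_nonneg_nonneg sum_nonneg kl_nonneg) (auto simp: less_imp_le)

text \<open>Pythagorean identity: the two sides differ by the divergence of the block means of p
  from the probabilities of f. Hence the block means can stand in for any minimizer of the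
  divergence.\<close>

lemma KL_n_ge_part_mean:
  fixes f0 :: "nat \<Rightarrow> real"
  assumes m: "interval_partition n m" and f: "f \<in> S_m m" and n: "0 < n"
  defines "p \<equiv> \<lambda>i. logistic (f0 i)"
  shows "(\<Sum>i\<in>{1..n}. kl (p i) (part_mean m p i)) \<le> real n * KL_n n f0 f"
proof -
  let ?q = "\<lambda>i. logistic (f i)" and ?r = "part_mean m p"
  have p01: "0 < p i \<and> p i < 1" for i using logistic_bounds by (simp add: p_def)
  have r01: "0 < ?r i \<and> ?r i < 1" if "i \<in> {1..n}" for i
    using part_mean_in_01[OF m that, of p] p01 by auto
  have q: "?q \<in> S_m m" using f by (rule S_m_map)
  have "(\<Sum>i\<in>{1..n}. kl (p i) (?q i)) - (\<Sum>i\<in>{1..n}. kl (p i) (?r i)) =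
      (\<Sum>i\<in>{1..n}. (p i * ln (?r i) + (1 - p i) * ln (1 - ?r i)) - (p i * ln (?q i) + (1 - p i) * ln (1 - ?q i)))"
    unfolding sum_subtractf[symmetric]
  proof (intro sum.cong refl)
    fix i assume i: "i \<in> {1..n}"
    show "kl (p i) (?q i) - kl (p i) (?r i) =
      (p i * ln (?r i) + (1 - p i) * ln (1 - ?r i)) - (p i * ln (?q i) + (1 - p i) * ln (1 - ?q i))"
      using p01[of i] r01[OF i] logistic_bounds[of "f i"] by (simp add: kl_def ln_div algebra_simps)
  qed
  also have "\<dots> = (\<Sum>i\<in>{1..n}. kl (?r i) (?q i)) - (\<Sum>i\<in>{1..n}. kl (?r i) (?r i))"
    by (rule sum_kl_part_mean[OF m part_mean_in_S_m[OF m] _ q]) (use r01 logistic_bounds in auto)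
  also have "\<dots> = (\<Sum>i\<in>{1..n}. kl (?r i) (?q i))" by (simp add: kl_refl)
  also have "0 \<le> \<dots>" using r01 logistic_bounds by (intro sum_nonneg kl_nonneg) (auto simp: less_imp_le)
  finally show ?thesis using n by (simp add: KL_n_eq p_def)
qed

lemma hell2_n_le_1:
  assumes "\<And>i. i \<in> {1..n} \<Longrightarrow> 0 \<le> p i \<and> p i \<le> 1" "\<And>i. i \<in> {1..n} \<Longrightarrow> 0 \<le> q i \<and> q i \<le> 1"
  shows "hell2_n n p q \<le> 1"
proof -
  have "(\<Sum>i\<in>{1..n}. hell (p i) (q i)) \<le> (\<Sum>i\<in>{1..n}. 1)"
  proof (rule sum_mono)
    fix i assume i: "i \<in> {1..n}"
    have "0 \<le> sqrt (p i * q i)" "0 \<le> sqrt ((1 - p i) * (1 - q i))"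
      using assms[OF i] by auto
    then show "hell (p i) (q i) \<le> 1"
      using assms[OF i] hell_eq[of "p i" "q i"] by linarith
  qed
  then show ?thesis by (auto simp: hell2_n_eq divide_le_eq_1)
qed

text \<open>A nonempty union of blocks of \<open>mf\<close> contains one of them.\<close>

lemma refines_card_le:
  assumes mf: "interval_partition n mf" and m: "interval_partition n m" and r: "refines mf m"
    and J: "J \<in> m" and c: "\<And>K. K \<in> mf \<Longrightarrow> c \<le> real (card K)"
  shows "c \<le> real (card J)"
proof -
  have f: "finite J" "J \<noteq> {}" using interval_partition_facts(4)[OF m J] by auto
  obtain F where F: "F \<subseteq> mf" "J = \<Union>F" using r J unfolding refines_def by blast
  then obtain K where K: "K \<in> F" using f by blast
  then have "c \<le> real (card K)" using F c by blast
  also have "card K \<le> card J" using K F f by (intro card_mono) auto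
  finally show ?thesis by simp
qed

theorem theorem4p1:
  fixes \<rho> \<mu> \<Gamma> \<Sigma> :: real
  assumes "\<rho> > 0" and "\<mu> > 1" and "\<Gamma> > 0"
  shows "\<exists>C::real. \<forall>(n::nat) (f0::nat \<Rightarrow> real) (mf::nat set set) (M::nat set set set)
      (L::nat set set \<Rightarrow> real) (pen::nat set set \<Rightarrow> real)
      (fm::nat set set \<Rightarrow> nat \<Rightarrow> real) (mhat::nat set \<Rightarrow> nat set set)
      (ptilde::nat set \<Rightarrow> nat \<Rightarrow> real).
    (\<forall>i\<in>{1..n}. logistic (f0 i) \<ge> \<rho> \<and> 1 - logistic (f0 i) \<ge> \<rho>) \<and>
    interval_partition n mf \<and>
    (\<forall>J\<in>mf. real (card J) \<ge> \<Gamma> * (ln (real n))^2) \<and>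
    (\<forall>m\<in>M. interval_partition n m \<and> refines mf m) \<and>
    (\<forall>m\<in>M. L m > 0) \<and>
    \<Sigma> = (\<Sum>m\<in>M. exp (- L m * real (card m))) \<and>
    (\<forall>m\<in>M. pen m \<ge> 0 \<and>
       pen m \<ge> \<mu> * (real (card m) / real n) * (1 + 6 * L m + 8 * sqrt (L m))) \<and>
    (\<forall>m\<in>M. fm m \<in> S_m m \<and> (\<forall>f\<in>S_m m. KL_n n f0 (fm m) \<le> KL_n n f0 f)) \<and>
    (\<forall>Y\<in>Pow {1..n}. mhat Y \<in> M \<and>
       (\<forall>m\<in>M. min_gamma n (mhat Y) Y + pen (mhat Y) \<le> min_gamma n m Y + pen m) \<and>
       is_mce n (mhat Y) Y (ptilde Y))
    \<longrightarrow>
    expect_n n f0 (\<lambda>Y. hell2_n n (\<lambda>i. logistic (f0 i)) (ptilde Y))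
      \<le> (2 * root 3 \<mu> / (root 3 \<mu> - 1)) * (INF m\<in>M. KL_n n f0 (fm m) + pen m) + C / real n"
proof -
  \<comment> \<open>\<open>N0\<close> is the block size required by \<open>block_dev_mean\<close>; R
    is the value of n from which \<Gamma> ln(n)^2 reaches it.\<close>
  define N0 where "N0 = 320 * (5 / (18 * \<rho> ^ 4) + 2 / (3 * \<rho> ^ 3))"
  define R where "R = exp (sqrt (N0 / \<Gamma>))"
  define c where "c = 2 * root 3 \<mu> / (root 3 \<mu> - 1)"
  have N0: "0 \<le> N0" using assms by (simp add: N0_def)
  have "1 < root 3 \<mu>" using assms by simp
  then have c: "2 \<le> c" by (simp add: c_def field_simps)
  show ?thesis
  \<comment> \<open>For 0 < n < R the loss is at most 1 \<le> R / n; from R on,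
    \<open>expected_loss_le\<close> contributes 60 \<Sigma> / n.\<close>
  proof (intro exI[of _ "R + 60 * \<bar>\<Sigma>\<bar>"] allI impI, elim conjE, unfold c_def[symmetric])
    fix n :: nat and f0 :: "nat \<Rightarrow> real" and mf :: "nat set set" and M :: "nat set set set"
      and L pen :: "nat set set \<Rightarrow> real" and fm :: "nat set set \<Rightarrow> nat \<Rightarrow> real"
      and mhat :: "nat set \<Rightarrow> nat set set" and pt :: "nat set \<Rightarrow> nat \<Rightarrow> real"
    assume p: "\<forall>i\<in>{1..n}. logistic (f0 i) \<ge> \<rho> \<and> 1 - logistic (f0 i) \<ge> \<rho>"
      and mf: "interval_partition n mf" and card: "\<forall>J\<in>mf. real (card J) \<ge> \<Gamma> * (ln (real n))^2"
      and M: "\<forall>m\<in>M. interval_partition n m \<and> refines mf m"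
      and L: "\<forall>m\<in>M. L m > 0" and \<Sigma>: "\<Sigma> = (\<Sum>m\<in>M. exp (- L m * real (card m)))"
      and pen: "\<forall>m\<in>M. pen m \<ge> 0 \<and>
        pen m \<ge> \<mu> * (real (card m) / real n) * (1 + 6 * L m + 8 * sqrt (L m))"
      and fm: "\<forall>m\<in>M. fm m \<in> S_m m \<and> (\<forall>f\<in>S_m m. KL_n n f0 (fm m) \<le> KL_n n f0 f)"
      and sel: "\<forall>Y\<in>Pow {1..n}. mhat Y \<in> M \<and>
        (\<forall>m\<in>M. min_gamma n (mhat Y) Y + pen (mhat Y) \<le> min_gamma n m Y + pen m) \<and>
        is_mce n (mhat Y) Y (pt Y)"
    let ?p = "\<lambda>i. logistic (f0 i)"
    let ?I = "INF m\<in>M. KL_n n f0 (fm m) + pen m"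
    let ?E = "expect_n n f0 (\<lambda>Y. hell2_n n ?p (pt Y))"
    have ne: "M \<noteq> {}" using sel by blast
    have I0: "0 \<le> ?I"
      using ne pen KL_n_nonneg by (intro cINF_greatest) (auto intro: add_nonneg_nonneg)
    have S0: "0 \<le> \<Sigma>" unfolding \<Sigma> by (intro sum_nonneg) auto
    show "?E \<le> c * ?I + (R + 60 * \<bar>\<Sigma>\<bar>) / real n"
    proof (cases "n = 0 \<or> real n < R")
      case True
      have cI: "0 \<le> c * ?I" using c I0 by simp
      show ?thesis
      proof (cases "n = 0")
        case True
        \<comment> \<open>For n = 0 every division by n gives 0, and the claim reduces to
          nonnegativity of the infimum.\<close>
        then show ?thesis using cI by (simp add: expect_n_eq hell2_n_def)
      next
        case False
        have "?E \<le> bern_expect ?p {1..n} (\<lambda>_. 1)"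
          unfolding expect_n_eq
        proof (rule bern_expect_mono)
          fix Y assume Y: "Y \<subseteq> {1..n}"
          then have mY: "interval_partition n (mhat Y)" "is_mce n (mhat Y) Y (pt Y)" using sel M by auto
          show "hell2_n n ?p (pt Y) \<le> 1"
          proof (rule hell2_n_le_1)
            fix i assume i: "i \<in> {1..n}"
            show "0 \<le> pt Y i \<and> pt Y i \<le> 1"
              using is_mce_eq_part_mean[OF _ mY i] empirical_bounds[OF mY(1) i] False by simp
          qed (use logistic_bounds in \<open>auto simp: less_imp_le\<close>)
        qed (use logistic_bounds in \<open>auto simp: less_imp_le\<close>)
        also have "\<dots> = 1" by (simp add: bern_expect_const)
        also have "\<dots> \<le> (R + 60 * \<bar>\<Sigma>\<bar>) / real n"
          using True False by (auto simp: field_simps)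
        finally show ?thesis using cI by simp
      qed
    next
      case False
      then have n: "0 < n" and nR: "R \<le> real n" by auto
      have "sqrt (N0 / \<Gamma>) \<le> ln (real n)"
        using nR n unfolding R_def by (subst ln_ge_iff) auto
      then have "(sqrt (N0 / \<Gamma>))\<^sup>2 \<le> (ln (real n))\<^sup>2"
        using N0 assms by (intro power_mono) auto
      then have "N0 \<le> \<Gamma> * (ln (real n))\<^sup>2"
        using N0 assms by (simp add: field_simps)
      then have large: "N0 \<le> real (card J)" if "m \<in> M" "J \<in> m" for m J
        using that M card mf by (intro refines_card_le[of n mf m J N0]) force+
      have pen': "real (card m) * (1 + 6 * L m + 8 * sqrt (L m)) \<le> real n * pen m" if m: "m \<in> M" for m
      proof -
        have "0 \<le> real (card m) * (1 + 6 * L m + 8 * sqrt (L m))" (is "0 \<le> ?b")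
          using L m by (intro mult_nonneg_nonneg) (auto simp: less_imp_le add_nonneg_nonneg)
        then have "?b \<le> \<mu> * ?b" using assms mult_right_mono[of 1 \<mu> ?b] by simp
        also have "\<dots> = real n * (\<mu> * (real (card m) / real n) * (1 + 6 * L m + 8 * sqrt (L m)))"
          using n by simp
        also have "\<dots> \<le> real n * pen m" using pen m by (intro mult_left_mono) auto
        finally show ?thesis .
      qed
      have finM: "finite M"
        by (rule finite_subset[of _ "Pow (Pow {1..n})"])
          (use M interval_partition_facts(4) in blast, simp)
      have E: "?E = bern_expect ?p {1..n} (\<lambda>Y. \<Sum>i\<in>{1..n}. hell (?p i) (pt Y i)) / real n"
        unfolding expect_n_eq hell2_n_eq
        using bern_expect_cmult[of ?p "{1..n}" "1 / real n"] by simp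
      \<comment> \<open>Solved for the infimum, the bound can be proved for one m at a time.\<close>
      have "(?E - 60 * \<Sigma> / real n) / c \<le> ?I"
      proof (rule cINF_greatest[OF ne])
        fix m assume m: "m \<in> M"
        have "bern_expect ?p {1..n} (\<lambda>Y. \<Sum>i\<in>{1..n}. hell (?p i) (pt Y i)) \<le>
            2 * ((\<Sum>i\<in>{1..n}. kl (?p i) (part_mean m ?p i)) + real n * pen m) + 60 * \<Sigma>"
          unfolding \<Sigma>
        proof (rule expected_loss_le[OF n assms(1) _ finM _ _ _ pen' _ m])
          show "mhat Y \<in> M \<and> (\<forall>m\<in>M. min_gamma n (mhat Y) Y + pen (mhat Y) \<le> min_gamma n m Y + pen m) \<and>
              is_mce n (mhat Y) Y (pt Y)" if "Y \<subseteq> {1..n}" for Y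
            using sel that by blast
        qed (use p M large L in \<open>auto simp: N0_def\<close>)
        also have "\<dots> \<le> 2 * (real n * KL_n n f0 (fm m) + real n * pen m) + 60 * \<Sigma>"
          using KL_n_ge_part_mean[of n m "fm m" f0] M fm m n by simp
        finally have "?E \<le> 2 * (KL_n n f0 (fm m) + pen m) + 60 * \<Sigma> / real n"
          unfolding E using n by (simp add: field_simps)
        also have "2 * (KL_n n f0 (fm m) + pen m) \<le> c * (KL_n n f0 (fm m) + pen m)"
          using c KL_n_nonneg pen m by (intro mult_right_mono add_nonneg_nonneg) auto
        finally show "(?E - 60 * \<Sigma> / real n) / c \<le> KL_n n f0 (fm m) + pen m"
          using c by (simp add: field_simps)
      qed
      then have "?E \<le> c * ?I + 60 * \<Sigma> / real n"
        using c by (simp add: field_simps)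
      also have "60 * \<Sigma> / real n \<le> (R + 60 * \<bar>\<Sigma>\<bar>) / real n"
        using S0 by (intro divide_right_mono) (auto simp: R_def)
      finally show ?thesis by simp
    qed
  qed
qed

end
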